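(* Let $d\in\mathbb{N}$ and let $f$ be a non-constant Bernstein function. Then $V_{f(-\Delta)}=V_{(-\Delta)}$, where $V_{(-\Delta)}$ denotes the space $V_{g(-\Delta)}$ for $g(\lambda)=\lambda$.
   Context: Bernstein function: $f:[0,\infty)\to\mathbb{R}$ is a Bernstein function with (Lévy) triple $(a,b,\mu)$ if $f(\lambda)=a+b\lambda+\int_{(0,\infty)}(1-e^{-\lambda t})\,\mu(dt)$ for $\lambda>0$, where $a,b\ge 0$ and $\mu$ is a measure on $(0,\infty)$ with $\int_{(0,\infty)}(1\wedge t)\,\mu(dt)<\infty$. Fourier transform: $\hat\varphi(\xi)=\mathcal{F}(\varphi)(\xi)=\int_{\mathbb{R}^d}\varphi(x)e^{-ix\cdot\xi}\,dx$ for $\varphi\in\mathcal{S}(\mathbb{R}^d)$, extended to tempered distributions $\mathcal{S}'(\mathbb{R}^d)$ by duality. $\mathcal{Z}(\mathbb{R}^d):=\{\varphi\in\mathcal{S}(\mathbb{R}^d):\partial^\alpha\hat\varphi(0)=0 \text{ for all }\alpha\in\mathbb{N}_0^d\}$ (topology inherited from $\mathcal{S}(\mathbb{R}^d)$), and $\mathcal{Z}'(\mathbb{R}^d)$ is its topological dual. Every $u\in\mathcal{Z}'(\mathbb{R}^d)$ extends to an element of $\mathcal{S}'(\mathbb{R}^d)$, uniquely modulo polynomials. The operator $f(-\Delta):\mathcal{Z}(\mathbb{R}^d)\to\mathcal{Z}(\mathbb{R}^d)$ is $\varphi\mapsto\mathcal{F}^{-1}(f(|\cdot|^2)\hat\varphi)$.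 Solution: $u$ is a solution of $f(-\Delta)u=f(1)u$ if $u\in\mathcal{Z}'(\mathbb{R}^d)$, $\langle u,f(-\Delta)\varphi\rangle=\langle u,f(1)\varphi\rangle$ for all $\varphi\in\mathcal{Z}(\mathbb{R}^d)$, and $0\notin\operatorname{supp}\hat u$. The last condition means that $u$ has an extension in $\mathcal{S}'(\mathbb{R}^d)$ whose Fourier transform has support not containing $0$; this extension is unique and $u$ is identified with it. $V_{f(-\Delta)}$ is the vector space of all such solutions.
   Formalization: "Non-constant" is taken to mean non-constant on (0,∞): the representation leaves f(0) free, and for f=1 on (0,∞) with f(0)=0 the operator is the identity and the claim fails; with f(0)=f(0+) the two conditions agree. *)

theory Defs
  imports "HOL-Analysis.Analysis"
begin

section \<open>Bernstein functions\<close>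

text \<open>A measure on \<open>(0,\<infinity>)\<close> is a measure on the Borel sigma-algebra of that interval. As usual, the
  representation is only required for positive arguments, so the value of \<open>f\<close> at 0 is not
  constrained by it; the values of \<open>f\<close> at negative arguments are junk and are never used.\<close>

definition levy_triple :: "(real \<Rightarrow> real) \<Rightarrow> real \<Rightarrow> real \<Rightarrow> real measure \<Rightarrow> bool" where
  "levy_triple f a b \<mu> \<longleftrightarrow>
     0 \<le> a \<and> 0 \<le> b \<and> sets \<mu> = sets (restrict_space borel {0<..}) \<and>
     (\<integral>\<^sup>+ t. ennreal (min 1 t) \<partial>\<mu>) < \<infinity> \<and>
     (\<forall>s>0. f s = a + b * s + (LINT t|\<mu>. 1 - exp (- s * t)))"

definition bernstein_function :: "(real \<Rightarrow> real) \<Rightarrow> bool" where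
  "bernstein_function f \<longleftrightarrow> (\<exists>a b \<mu>. levy_triple f a b \<mu>)"

section \<open>Schwartz space\<close>

text \<open>Higher partial derivatives are indexed by the list of coordinates along which one
  differentiates. For smooth functions the order of the list is irrelevant, and the lists
  in which each \<open>i\<close> occurs \<open>\<alpha> i\<close> times represent the multi-index \<open>\<alpha>\<close>.\<close>

fun pderivs :: "'d list \<Rightarrow> (real ^ 'd \<Rightarrow> complex) \<Rightarrow> real ^ 'd \<Rightarrow> complex" where
  "pderivs [] \<phi> = \<phi>"
| "pderivs (i # is) \<phi> = (\<lambda>x. frechet_derivative (pderivs is \<phi>) (at x) (axis i 1))"

definition smooth :: "(real ^ 'd \<Rightarrow> complex) \<Rightarrow> bool" where
  "smooth \<phi> \<longleftrightarrow> (\<forall>is. pderivs is \<phi> differentiable_on UNIV)"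

definition schwartz :: "(real ^ 'd \<Rightarrow> complex) set" where
  "schwartz = {\<phi>. smooth \<phi> \<and>
     (\<forall>k is. bdd_above (range (\<lambda>x. (1 + norm x) ^ k * norm (pderivs is \<phi> x))))}"

definition schwartz_seminorm :: "nat \<Rightarrow> 'd list \<Rightarrow> (real ^ 'd \<Rightarrow> complex) \<Rightarrow> real" where
  "schwartz_seminorm k is \<phi> = (SUP x. (1 + norm x) ^ k * norm (pderivs is \<phi> x))"

text \<open>The locally convex topology generated by the Schwartz seminorms: the seminorm balls form
  a subbase.\<close>

definition schwartz_topology :: "(real ^ 'd \<Rightarrow> complex) topology" where
  "schwartz_topology = topology_generated_by
     {{\<psi> \<in> schwartz. schwartz_seminorm k is (\<lambda>x. \<psi> x - \<phi> x) < \<epsilon>} |k is \<phi> \<epsilon>.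
        \<phi> \<in> schwartz \<and> 0 < \<epsilon>}"

lemma topspace_schwartz_topology: "topspace schwartz_topology = schwartz"
proof -
  let ?B = "\<lambda>k is \<phi> \<epsilon>. {\<psi> \<in> schwartz. schwartz_seminorm k is (\<lambda>x. \<psi> x - \<phi> x) < \<epsilon>}"
  let ?F = "{?B k is \<phi> \<epsilon> |k is \<phi> \<epsilon>. \<phi> \<in> schwartz \<and> 0 < \<epsilon>}"
  have "\<phi> \<in> \<Union>?F" if \<phi>: "\<phi> \<in> schwartz" for \<phi> :: "real ^ 'd \<Rightarrow> complex"
  proof (rule UnionI)
    show "?B 0 [] \<phi> 1 \<in> ?F"
      using \<phi> zero_less_one by blast
    show "\<phi> \<in> ?B 0 [] \<phi> 1"
      using \<phi> by (simp add: schwartz_seminorm_def)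
  qed
  moreover have "\<Union>?F \<subseteq> schwartz"
    by blast
  ultimately show ?thesis
    unfolding schwartz_topology_def topology_generated_by_topspace by blast
qed

section \<open>Fourier transform and the space \<open>Z\<close>\<close>

definition fourier :: "(real ^ 'd \<Rightarrow> complex) \<Rightarrow> real ^ 'd \<Rightarrow> complex" where
  "fourier \<phi> \<xi> = (LINT x|lborel. \<phi> x * exp (- \<i> * complex_of_real (x \<bullet> \<xi>)))"

definition inv_fourier :: "(real ^ 'd \<Rightarrow> complex) \<Rightarrow> real ^ 'd \<Rightarrow> complex" where
  "inv_fourier \<psi> x = (LINT \<xi>|lborel. \<psi> \<xi> * exp (\<i> * complex_of_real (x \<bullet> \<xi>))) / (2 * pi) ^ CARD('d)"

definition Z_space :: "(real ^ 'd \<Rightarrow> complex) set" where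
  "Z_space = {\<phi> \<in> schwartz. \<forall>is. pderivs is (fourier \<phi>) 0 = 0}"

definition Z_topology :: "(real ^ 'd \<Rightarrow> complex) topology" where
  "Z_topology = subtopology schwartz_topology Z_space"

lemma topspace_Z_topology: "topspace Z_topology = Z_space"
  by (auto simp: Z_topology_def topspace_schwartz_topology Z_space_def)

section \<open>Dual spaces\<close>

text \<open>Functionals are extensional, i.e. \<open>undefined\<close> outside the underlying space, so that
  equality of functionals is equality on that space.\<close>

definition topological_dual ::
    "('a \<Rightarrow> complex) topology \<Rightarrow> (('a \<Rightarrow> complex) \<Rightarrow> complex) set" where
  "topological_dual T = {u \<in> extensional (topspace T).
     (\<forall>\<phi>\<in>topspace T. \<forall>\<psi>\<in>topspace T. u (\<lambda>x. \<phi> x + \<psi> x) = u \<phi> + u \<psi>) \<and>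
     (\<forall>c. \<forall>\<phi>\<in>topspace T. u (\<lambda>x. c * \<phi> x) = c * u \<phi>) \<and>
     continuous_map T euclidean u}"

definition tempered_distributions :: "((real ^ 'd \<Rightarrow> complex) \<Rightarrow> complex) set" where
  "tempered_distributions = topological_dual schwartz_topology"

definition Z_dual :: "((real ^ 'd \<Rightarrow> complex) \<Rightarrow> complex) set" where
  "Z_dual = topological_dual Z_topology"

definition fourier_distribution ::
    "((real ^ 'd \<Rightarrow> complex) \<Rightarrow> complex) \<Rightarrow> (real ^ 'd \<Rightarrow> complex) \<Rightarrow> complex" where
  "fourier_distribution w = (\<lambda>\<phi>\<in>schwartz. w (fourier \<phi>))"

definition test_functions :: "(real ^ 'd) set \<Rightarrow> (real ^ 'd \<Rightarrow> complex) set" where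
  "test_functions U = {\<phi>. smooth \<phi> \<and> compact (closure {x. \<phi> x \<noteq> 0}) \<and> closure {x. \<phi> x \<noteq> 0} \<subseteq> U}"

text \<open>The complement of the largest open set on which \<open>w\<close> vanishes.\<close>

definition distribution_support :: "((real ^ 'd \<Rightarrow> complex) \<Rightarrow> complex) \<Rightarrow> (real ^ 'd) set" where
  "distribution_support w = - \<Union>{U. open U \<and> (\<forall>\<phi>\<in>test_functions U. w \<phi> = 0)}"

section \<open>The operator \<open>f(-\<Delta>)\<close> and the solution space\<close>

definition fun_neg_laplacian ::
    "(real \<Rightarrow> real) \<Rightarrow> (real ^ 'd \<Rightarrow> complex) \<Rightarrow> real ^ 'd \<Rightarrow> complex" where
  "fun_neg_laplacian f \<phi> = inv_fourier (\<lambda>\<xi>. complex_of_real (f ((norm \<xi>)\<^sup>2)) * fourier \<phi> \<xi>)"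

definition solution_space :: "(real \<Rightarrow> real) \<Rightarrow> ((real ^ 'd \<Rightarrow> complex) \<Rightarrow> complex) set" where
  "solution_space f = {u \<in> Z_dual.
     (\<forall>\<phi>\<in>Z_space. u (fun_neg_laplacian f \<phi>) = u (\<lambda>x. complex_of_real (f 1) * \<phi> x)) \<and>
     (\<exists>w\<in>tempered_distributions. (\<forall>\<phi>\<in>Z_space. w \<phi> = u \<phi>) \<and>
        0 \<notin> distribution_support (fourier_distribution w))}"

end

theory Submission
  imports Defs "HOL-Probability.Probability"
begin

text \<open>On the Fourier side the equation \<open>f(-\<Delta>)u = f(1)u\<close> says that \<open>u\<close> annihilates the inverse Fourier
  transforms of all \<open>(f(\<bar>\<xi>\<bar>\<^sup>2) - f(1)) \<psi>\<close>, where \<open>\<psi>\<close> runs through the Schwartz functions vanishing to infinite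
  order at 0. Write \<open>f(s) - f(1) = (s - 1) h(s)\<close>. For a non-constant Bernstein function \<open>f\<close> both \<open>h\<close> and
  \<open>1/h\<close> are smooth on \<open>(0,\<infinity>)\<close> with all derivatives bounded by multiples of powers of \<open>s + 1/s\<close>, so
  multiplication by \<open>h(\<bar>\<xi>\<bar>\<^sup>2)\<close> is a bijection of this class of functions \<open>\<psi>\<close>, and the conditions for \<open>f\<close>
  and for the identity agree.\<close>

section \<open>Differentiation under the integral sign\<close>


text \<open>Membership in \<open>Z_dual\<close> and the support condition are literally the same in
  both solution spaces, so only the equation has to be transferred, for each fixed functional
  \<open>u\<close>. The obstacle lies at the two ends of the half-line. For the square root, for
  instance, h(s) = 1/(1 + sqrt s): its derivatives blow up at 0 and its reciprocal grows at
  infinity. The single weight s + 1/s measures both effects, and the infinite order of vanishing of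
  psi absorbs the singularities at the origin. The weighted classes are defined by recursion on the
  order, with an existential derivative at each level; products, reciprocals and averages then need
  only a first-order differentiation rule, and no formula for higher derivatives occurs. The same
  economy is used for the Schwartz space, through sets of functions invariant under taking
  gradients. Passing to the Fourier side and back requires inversion on Schwartz functions, which is
  derived from the Gaussian.\<close>

lemma has_derivative_of_quadratic_remainder:
  fixes f :: "'a::real_normed_vector \<Rightarrow> 'b::real_normed_vector"
  assumes D: "bounded_linear D" and d: "d > 0"
    and bd: "\<And>h. norm h < d \<Longrightarrow> norm (f (a + h) - f a - D h) \<le> (norm h)\<^sup>2 * C"
  shows "(f has_derivative D) (at a)"
  unfolding has_derivative_at
proof (intro conjI D)
  show "(\<lambda>h. norm (f (a + h) - f a - D h) / norm h) \<midarrow>0\<rightarrow> 0"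
  proof (rule Lim_null_comparison)
    have "norm (f (a + h) - f a - D h) / norm h \<le> norm h * C" if "h \<noteq> 0" "norm h < d" for h
      using bd[OF that(2)] that by (simp add: field_simps power2_eq_square)
    then show "\<forall>\<^sub>F h in at 0. norm (norm (f (a + h) - f a - D h) / norm h) \<le> norm h * C"
      unfolding eventually_at using d by (intro exI[of _ d]) auto
    have "((\<lambda>h::'a. norm h * C) \<longlongrightarrow> norm (0::'a) * C) (at 0)"
      by (intro tendsto_intros)
    then show "((\<lambda>h::'a. norm h * C) \<longlongrightarrow> 0) (at 0)"
      by simp
  qed
qed

text \<open>An integrable coefficient \<open>K\<close> of the quadratic remainder reduces
  differentiation under the integral to one estimate at the point \<open>a\<close>, with no limit
  theorem. It serves the Laplace transforms, the gradient of a Fourier transform and the translation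
  argument alike.\<close>

lemma has_derivative_integral_of_quadratic_remainder:
  fixes F :: "'a::real_normed_vector \<Rightarrow> 'b \<Rightarrow> 'c::{banach, second_countable_topology}"
  assumes d: "d > 0"
    and F: "\<And>h. norm h < d \<Longrightarrow> integrable M (F (a + h))"
    and D: "bounded_linear (\<lambda>h. \<integral>x. F' h x \<partial>M)"
    and F': "\<And>h. integrable M (F' h)"
    and K: "integrable M K"
    and bd: "\<And>h x. norm h < d \<Longrightarrow> x \<in> space M \<Longrightarrow>
      norm (F (a + h) x - F a x - F' h x) \<le> (norm h)\<^sup>2 * K x"
  shows "((\<lambda>y. \<integral>x. F y x \<partial>M) has_derivative (\<lambda>h. \<integral>x. F' h x \<partial>M)) (at a)"
proof (rule has_derivative_of_quadratic_remainder[OF D d])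
  fix h :: 'a assume h: "norm h < d"
  have Fa: "integrable M (F a)" using F[of 0] d by simp
  have "norm ((\<integral>x. F (a + h) x \<partial>M) - (\<integral>x. F a x \<partial>M) - (\<integral>x. F' h x \<partial>M))
      = norm (\<integral>x. F (a + h) x - F a x - F' h x \<partial>M)"
    using F[OF h] Fa F'[of h] by simp
  also have "\<dots> \<le> (\<integral>x. norm (F (a + h) x - F a x - F' h x) \<partial>M)"
    by (rule integral_norm_bound)
  also have "\<dots> \<le> (\<integral>x. (norm h)\<^sup>2 * K x \<partial>M)"
    by (rule integral_mono) (use F[OF h] Fa F'[of h] K bd[OF h] in auto)
  finally show "norm ((\<integral>x. F (a + h) x \<partial>M) - (\<integral>x. F a x \<partial>M) - (\<integral>x. F' h x \<partial>M))
      \<le> (norm h)\<^sup>2 * (\<integral>x. K x \<partial>M)"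
    by simp
qed

section \<open>Smooth functions of moderate growth on the half-line\<close>

text \<open>One weight for both ends of the half-line: it is at least 1 there and dominates
  \<open>s\<close> as well as \<open>inverse s\<close>, so its powers bound growth at infinity and
  poles at 0 simultaneously.\<close>

definition pole_weight :: "real \<Rightarrow> real" where "pole_weight s = s + inverse s"

lemma pole_weight_ge_1: "s > 0 \<Longrightarrow> 1 \<le> pole_weight s"
  unfolding pole_weight_def by (smt (verit) one_le_inverse positive_imp_inverse_positive)

lemma pole_weight_ge: "s > 0 \<Longrightarrow> s \<le> pole_weight s" "s > 0 \<Longrightarrow> inverse s \<le> pole_weight s"
  by (auto simp: pole_weight_def)

text \<open>The weight decreases on (0,1] and increases afterwards, so it cannot grow when
  \<open>s\<close> moves towards 1. Both cases read the sign off the factorisation of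
  \<open>pole_weight y - pole_weight s\<close> as (y - s)(y s - 1)/(y s).\<close>

lemma pole_weight_between:
  assumes "s > 0" "0 \<le> t" "t \<le> 1"
  shows "1 + t * (s - 1) > 0" "pole_weight (1 + t * (s - 1)) \<le> pole_weight s"
proof -
  let ?y = "1 + t * (s - 1)"
  have y_eq: "?y = (1 - t) * 1 + t * s" by (simp add: algebra_simps)
  have y: "min 1 s \<le> ?y" "?y \<le> max 1 s"
    using assms convex_bound_le[of 1 "max 1 s" s "1 - t" t]
      convex_bound_le[of "- 1" "- min 1 s" "- s" "1 - t" t]
    unfolding y_eq by simp_all
  have pos: "?y > 0" using y(1) assms by linarith
  show "?y > 0" by (fact pos)
  show "pole_weight ?y \<le> pole_weight s"
  proof (cases "s \<le> 1")
    case True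
    then have "s \<le> ?y" "?y \<le> 1" using y by auto
    then have "(?y - s) * (?y * s - 1) \<le> 0"
      using True assms by (intro mult_nonneg_nonpos) (auto simp: mult_le_one)
    moreover have "pole_weight ?y - pole_weight s = (?y - s) * (?y * s - 1) / (?y * s)"
      using pos assms unfolding pole_weight_def by (simp add: divide_simps) algebra
    ultimately have "pole_weight ?y - pole_weight s \<le> 0"
      using pos assms by (simp add: divide_nonpos_pos)
    then show ?thesis by simp
  next
    case False
    then have "?y \<le> s" "1 \<le> ?y" using y by auto
    then have "(?y - s) * (?y * s - 1) \<le> 0"
      using False mult_mono[of 1 ?y 1 s] by (intro mult_nonpos_nonneg) auto
    moreover have "pole_weight ?y - pole_weight s = (?y - s) * (?y * s - 1) / (?y * s)"
      using pos assms unfolding pole_weight_def by (simp add: divide_simps) algebra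
    ultimately have "pole_weight ?y - pole_weight s \<le> 0"
      using pos assms by (simp add: divide_nonpos_pos)
    then show ?thesis by simp
  qed
qed

definition moderate_growth :: "(real \<Rightarrow> real) \<Rightarrow> bool" where
  "moderate_growth g \<longleftrightarrow> (\<exists>C k. 0 \<le> C \<and> (\<forall>s>0. \<bar>g s\<bar> \<le> C * pole_weight s ^ k))"

lemma moderate_growthI:
  assumes "\<And>s. s > 0 \<Longrightarrow> \<bar>g s\<bar> \<le> C * pole_weight s ^ k"
  shows "moderate_growth g"
proof -
  have "\<bar>g s\<bar> \<le> \<bar>C\<bar> * pole_weight s ^ k" if "s > 0" for s
  proof -
    have "C * pole_weight s ^ k \<le> \<bar>C\<bar> * pole_weight s ^ k"
      using pole_weight_ge_1[OF that] by (intro mult_right_mono) auto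
    then show ?thesis using assms[OF that] by linarith
  qed
  then show ?thesis
    unfolding moderate_growth_def by (intro exI[of _ "\<bar>C\<bar>"] exI[of _ k]) auto
qed

lemma moderate_growth_add:
  assumes "moderate_growth g" "moderate_growth h"
  shows "moderate_growth (\<lambda>s. g s + h s)"
proof -
  obtain C k D l where C: "0 \<le> C" "\<And>s. s > 0 \<Longrightarrow> \<bar>g s\<bar> \<le> C * pole_weight s ^ k"
    and D: "0 \<le> D" "\<And>s. s > 0 \<Longrightarrow> \<bar>h s\<bar> \<le> D * pole_weight s ^ l"
    using assms unfolding moderate_growth_def by metis
  show ?thesis
  proof (rule moderate_growthI[of _ "C + D" "k + l"])
    fix s :: real assume s: "s > 0"
    have "C * pole_weight s ^ k \<le> C * pole_weight s ^ (k + l)" "D * pole_weight s ^ l \<le> D * pole_weight s ^ (k + l)"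
      using C(1) D(1) pole_weight_ge_1[OF s] by (auto intro!: mult_left_mono power_increasing)
    then show "\<bar>g s + h s\<bar> \<le> (C + D) * pole_weight s ^ (k + l)"
      using C(2)[OF s] D(2)[OF s] by (simp add: distrib_right)
  qed
qed

lemma moderate_growth_mult:
  assumes "moderate_growth g" "moderate_growth h"
  shows "moderate_growth (\<lambda>s. g s * h s)"
proof -
  obtain C k D l where C: "0 \<le> C" "\<And>s. s > 0 \<Longrightarrow> \<bar>g s\<bar> \<le> C * pole_weight s ^ k"
    and D: "0 \<le> D" "\<And>s. s > 0 \<Longrightarrow> \<bar>h s\<bar> \<le> D * pole_weight s ^ l"
    using assms unfolding moderate_growth_def by metis
  show ?thesis
  proof (rule moderate_growthI[of _ "C * D" "k + l"])
    fix s :: real assume s: "s > 0"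
    have "\<bar>g s\<bar> * \<bar>h s\<bar> \<le> (C * pole_weight s ^ k) * (D * pole_weight s ^ l)"
      using C(2)[OF s] D(2)[OF s] C(1) pole_weight_ge_1[OF s] by (intro mult_mono) auto
    then show "\<bar>g s * h s\<bar> \<le> C * D * pole_weight s ^ (k + l)"
      by (simp add: abs_mult power_add ac_simps)
  qed
qed

text \<open>The nested existential lets each closure proof be an induction on \<open>n\<close> with
  a single differentiation rule. Only positive arguments count, so the value of a radial multiplier
  g(|x|^2) at the origin stays arbitrary.\<close>

primrec moderate :: "nat \<Rightarrow> (real \<Rightarrow> real) \<Rightarrow> bool" where
  "moderate 0 g \<longleftrightarrow> moderate_growth g"
| "moderate (Suc n) g \<longleftrightarrow> moderate_growth g \<and>
    (\<exists>g'. (\<forall>s>0. (g has_real_derivative g' s) (at s)) \<and> moderate n g')"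

lemma moderate_SucI:
  assumes "moderate_growth g" "\<And>s. s > 0 \<Longrightarrow> (g has_real_derivative g' s) (at s)" "moderate n g'"
  shows "moderate (Suc n) g"
  using assms by auto

lemma moderate_imp_growth: "moderate n g \<Longrightarrow> moderate_growth g"
  by (cases n) auto

lemma moderate_Suc_imp: "moderate (Suc n) g \<Longrightarrow> moderate n g"
  by (induction n arbitrary: g) auto

lemma moderate_const: "moderate n (\<lambda>s. c)"
proof (induction n arbitrary: c)
  case 0
  show ?case using moderate_growthI[of "\<lambda>s. c" "\<bar>c\<bar>" 0] by simp
next
  case (Suc n)
  show ?case
  proof (rule moderate_SucI)
    show "moderate_growth (\<lambda>s. c)"
      using moderate_growthI[of "\<lambda>s. c" "\<bar>c\<bar>" 0] by simp
  qed (rule DERIV_const, rule Suc)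
qed

lemma moderate_ident: "moderate n (\<lambda>s. s)"
proof -
  have gr: "moderate_growth (\<lambda>s. s)"
    using moderate_growthI[of "\<lambda>s. s" 1 1] pole_weight_ge(1) by simp
  show ?thesis
  proof (cases n)
    case 0
    then show ?thesis using gr by simp
  next
    case (Suc m)
    have "moderate (Suc m) (\<lambda>s. s)"
      by (rule moderate_SucI[OF gr DERIV_ident moderate_const])
    then show ?thesis using Suc by simp
  qed
qed

lemma moderate_add:
  "moderate n g \<Longrightarrow> moderate n h \<Longrightarrow> moderate n (\<lambda>s. g s + h s)"
proof (induction n arbitrary: g h)
  case 0
  then show ?case by (simp add: moderate_growth_add)
next
  case (Suc n)
  from Suc.prems obtain g' h'
    where g': "\<And>s. s > 0 \<Longrightarrow> (g has_real_derivative g' s) (at s)" "moderate n g'"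
      and h': "\<And>s. s > 0 \<Longrightarrow> (h has_real_derivative h' s) (at s)" "moderate n h'" by auto
  show ?case
    by (rule moderate_SucI[OF moderate_growth_add DERIV_add[OF g'(1) h'(1)] Suc.IH[OF g'(2) h'(2)]])
      (use Suc.prems in auto)
qed

lemma moderate_mult:
  "moderate n g \<Longrightarrow> moderate n h \<Longrightarrow> moderate n (\<lambda>s. g s * h s)"
proof (induction n arbitrary: g h)
  case 0
  then show ?case by (simp add: moderate_growth_mult)
next
  case (Suc n)
  from Suc.prems obtain g' h'
    where g': "\<And>s. s > 0 \<Longrightarrow> (g has_real_derivative g' s) (at s)" "moderate n g'"
      and h': "\<And>s. s > 0 \<Longrightarrow> (h has_real_derivative h' s) (at s)" "moderate n h'" by auto
  have *: "moderate n (\<lambda>s. g' s * h s + h' s * g s)"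
    using g'(2) h'(2) Suc.prems[THEN moderate_Suc_imp] by (intro moderate_add Suc.IH)
  show ?case
    by (rule moderate_SucI[OF moderate_growth_mult DERIV_mult[OF g'(1) h'(1)] *])
      (use Suc.prems in auto)
qed

text \<open>Since (1/h)' = - h' (1/h)^2, the derivative is a product of functions already controlled
  to order \<open>n\<close>. A bound on 1/h itself is therefore the only estimate to supply.\<close>

lemma moderate_inverse:
  assumes pos: "\<And>s. s > 0 \<Longrightarrow> h s \<noteq> 0" and gr: "moderate_growth (\<lambda>s. inverse (h s))"
  shows "moderate n h \<Longrightarrow> moderate n (\<lambda>s. inverse (h s))"
proof (induction n)
  case 0
  then show ?case using gr by simp
next
  case (Suc n)
  then obtain h' where h': "\<And>s. s > 0 \<Longrightarrow> (h has_real_derivative h' s) (at s)" "moderate n h'"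
    by auto
  have "moderate n (\<lambda>s. inverse (h s))"
    by (rule Suc.IH[OF moderate_Suc_imp[OF Suc.prems]])
  then have "moderate n (\<lambda>s. (- 1) * (h' s * (inverse (h s) * inverse (h s))))"
    using h' by (intro moderate_mult moderate_const)
  moreover have "((\<lambda>s. inverse (h s)) has_real_derivative
      (- 1) * (h' s * (inverse (h s) * inverse (h s)))) (at s)" if "s > 0" for s
    using h'(1)[OF that] pos[OF that] by (auto intro!: derivative_eq_intros)
  ultimately show ?case using gr by (intro moderate_SucI)
qed

section \<open>Averages over the segment from 1 to s\<close>

lemma continuous_on_halfline_of_DERIV:
  assumes "\<And>s::real. s > 0 \<Longrightarrow> (g has_real_derivative g' s) (at s)"
  shows "continuous_on {0<..} g"
  by (rule DERIV_continuous_on[where D = g']) (use assms in \<open>simp add: has_field_derivative_at_within\<close>)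

lemma moderate_continuous_on:
  assumes "moderate (Suc n) g"
  shows "continuous_on {0<..} g"
proof -
  obtain g' where "\<forall>s>0. (g has_real_derivative g' s) (at s)"
    using assms by auto
  then show ?thesis
    using continuous_on_halfline_of_DERIV[of g g'] by blast
qed

text \<open>The factor \<open>t ^ k\<close> makes the family of segment integrals closed under
  differentiation in \<open>s\<close>: each derivative brings out one more \<open>t\<close>.\<close>

lemma continuous_on_segment:
  assumes "continuous_on {0<..} g" "s > 0"
  shows "continuous_on {0..1} (\<lambda>t. t ^ k * g (1 + t * (s - 1)) :: real)"
  by (intro continuous_intros continuous_on_compose2[OF assms(1)])
     (use pole_weight_between[OF assms(2)] in auto)

text \<open>On the segment from 1 to \<open>s\<close> the weight is at most its value at
  \<open>s\<close>, so a bound on \<open>g\<close> passes through the average with unchanged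
  constant and exponent.\<close>

lemma moderate_growth_segment_integral:
  assumes cont: "continuous_on {0<..} g" and gr: "moderate_growth g"
  shows "moderate_growth (\<lambda>s. integral {0..1} (\<lambda>t. t ^ k * g (1 + t * (s - 1))))"
proof -
  obtain C l where C: "0 \<le> C" "\<And>s. s > 0 \<Longrightarrow> \<bar>g s\<bar> \<le> C * pole_weight s ^ l"
    using gr unfolding moderate_growth_def by metis
  show ?thesis
  proof (rule moderate_growthI[of _ C l])
    fix s :: real assume s: "s > 0"
    have "norm (integral {0..1} (\<lambda>t. t ^ k * g (1 + t * (s - 1)))) \<le> C * pole_weight s ^ l * (1 - 0)"
    proof (rule integral_bound)
      fix t :: real assume t: "t \<in> {0..1}"
      have y: "1 + t * (s - 1) > 0" "pole_weight (1 + t * (s - 1)) \<le> pole_weight s"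
        using pole_weight_between[OF s, of t] t by auto
      have "norm (t ^ k * g (1 + t * (s - 1))) \<le> 1 * \<bar>g (1 + t * (s - 1))\<bar>"
        unfolding real_norm_def abs_mult using t by (intro mult_right_mono) (auto simp: power_le_one)
      also have "\<dots> \<le> C * pole_weight (1 + t * (s - 1)) ^ l" using C(2)[OF y(1)] by simp
      also have "\<dots> \<le> C * pole_weight s ^ l"
        using y pole_weight_ge_1[OF y(1)] C(1) by (intro mult_left_mono power_mono) auto
      finally show "norm (t ^ k * g (1 + t * (s - 1))) \<le> C * pole_weight s ^ l" .
    qed (use continuous_on_segment[OF cont s] in auto)
    then show "\<bar>integral {0..1} (\<lambda>t. t ^ k * g (1 + t * (s - 1)))\<bar> \<le> C * pole_weight s ^ l"
      by simp
  qed
qed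

lemma DERIV_segment_integral:
  assumes g': "\<And>s. s > 0 \<Longrightarrow> (g has_real_derivative g' s) (at s)"
    and cont: "continuous_on {0<..} g'" and s: "s > 0"
  shows "((\<lambda>s. integral {0..1} (\<lambda>t. t ^ k * g (1 + t * (s - 1)))) has_real_derivative
    integral {0..1} (\<lambda>t. t ^ Suc k * g' (1 + t * (s - 1)))) (at s)"
proof -
  have cg: "continuous_on {0<..} g"
    using g' by (rule continuous_on_halfline_of_DERIV)
  have "((\<lambda>s. integral (cbox 0 1) (\<lambda>t. t ^ k * g (1 + t * (s - 1)))) has_field_derivative
    integral (cbox 0 1) (\<lambda>t. t ^ Suc k * g' (1 + t * (s - 1)))) (at s within {0<..})"
  proof (rule leibniz_rule_field_derivative)
    fix x t :: real assume x: "x \<in> {0<..}" and t: "t \<in> cbox 0 1"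
    then have pos: "1 + t * (x - 1) > 0" using pole_weight_between(1)[of x t] by auto
    have "((\<lambda>x. 1 + t * (x - 1)) has_field_derivative t) (at x within {0<..})"
      by (auto intro!: derivative_eq_intros)
    from DERIV_cmult[OF DERIV_chain2[OF g'[OF pos] this], of "t ^ k"]
    show "((\<lambda>x. t ^ k * g (1 + t * (x - 1))) has_field_derivative
        t ^ Suc k * g' (1 + t * (x - 1))) (at x within {0<..})"
      by (simp add: ac_simps)
  next
    fix x :: real assume "x \<in> {0<..}"
    then show "(\<lambda>t. t ^ k * g (1 + t * (x - 1))) integrable_on cbox 0 1"
      using continuous_on_segment[OF cg] by (auto intro!: integrable_continuous_real)
  next
    show "continuous_on ({0<..} \<times> cbox 0 1) (\<lambda>(x, t). t ^ Suc k * g' (1 + t * (x - 1)))"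
      unfolding split_beta
      by (intro continuous_intros continuous_on_compose2[OF cont]) (use pole_weight_between in auto)
  qed (use s in auto)
  then show ?thesis
    using s by (simp add: at_within_open[of s "{0<..}"])
qed

text \<open>One order is lost: differentiation under the integral needs continuous derivatives of
  \<open>g\<close>, and the continuity of each is read off from the next one. The loss is harmless,
  as the lemma is applied to a function that is moderate of every order.\<close>

lemma moderate_segment_integral:
  "moderate (Suc n) g \<Longrightarrow> moderate n (\<lambda>s. integral {0..1} (\<lambda>t. t ^ k * g (1 + t * (s - 1))))"
proof (induction n arbitrary: g k)
  case 0
  then show ?case
    using moderate_growth_segment_integral[OF moderate_continuous_on moderate_imp_growth]
    unfolding moderate.simps(1) by blast
next
  case (Suc n)
  from Suc.prems obtain g' where g': "\<And>s. s > 0 \<Longrightarrow> (g has_real_derivative g' s) (at s)"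
    "moderate (Suc n) g'" by auto
  show ?case
    using moderate_growth_segment_integral[OF moderate_continuous_on[OF Suc.prems]
        moderate_imp_growth[OF Suc.prems]]
      DERIV_segment_integral[OF g'(1) moderate_continuous_on[OF g'(2)]] Suc.IH[OF g'(2)]
    by (rule moderate_SucI)
qed


section \<open>Bernstein functions\<close>

lemma power_div_fact_le_exp:
  fixes x :: real
  assumes "x \<ge> 0"
  shows "x ^ n / fact n \<le> exp x"
proof -
  have "(\<Sum>m\<in>{n}. x ^ m /\<^sub>R fact m) \<le> exp x"
    unfolding exp_def by (rule sum_le_suminf) (use assms summable_exp in auto)
  then show ?thesis by (simp add: field_simps)
qed

text \<open>\<open>min 1 t\<close> is the function that a Levy measure integrates. For t \<le> 1 the
  left side is at most \<open>t\<close>; for t > 1 the term of order n + 1 in the series of exp(s t)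
  bounds it by (n + 1)!/s^(n + 1). The constant adds the two bounds.\<close>

lemma power_mult_exp_le:
  fixes s t :: real
  assumes "s > 0" "t > 0"
  shows "t ^ Suc n * exp (- s * t) \<le> (1 + fact (Suc n) * inverse s ^ Suc n) * min 1 t"
proof -
  have "(s * t) ^ Suc n / fact (Suc n) \<le> exp (s * t)"
    using power_div_fact_le_exp[of "s * t" "Suc n"] assms by simp
  then have "t ^ Suc n \<le> fact (Suc n) * inverse s ^ Suc n * exp (s * t)"
    using assms by (simp add: field_simps power_mult_distrib del: power_Suc fact_Suc)
  then have *: "t ^ Suc n * exp (- s * t) \<le> fact (Suc n) * inverse s ^ Suc n"
    by (simp add: exp_minus field_simps del: power_Suc fact_Suc)
  show ?thesis
  proof (cases "t \<le> 1")
    case True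
    have "t ^ Suc n * exp (- s * t) \<le> t * 1"
      using assms True by (intro mult_mono) (auto simp: mult_le_cancel_left1 power_le_one)
    also have "\<dots> \<le> (1 + fact (Suc n) * inverse s ^ Suc n) * t"
      using assms by (simp add: distrib_right del: power_Suc fact_Suc)
    finally show ?thesis using True by simp
  next
    case False
    then show ?thesis using * by simp
  qed
qed

text \<open>Everything comes from exp x \<ge> 1 + x. Taken at \<open>- z\<close> it gives e^z - 1 -
  z \<le> z (e^z - 1), and the factor e^z - 1 is in turn at most |z| e^|z| in absolute
  value.\<close>

lemma abs_exp_minus_affine_le:
  fixes z :: real
  shows "\<bar>exp z - 1 - z\<bar> \<le> z\<^sup>2 * exp \<bar>z\<bar>"
proof -
  have "exp z * (1 - z) \<le> exp z * exp (- z)"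
    using exp_ge_add_one_self[of "- z"] by (intro mult_left_mono) auto
  then have *: "exp z - 1 - z \<le> z * (exp z - 1)"
    by (simp add: exp_minus algebra_simps)
  have **: "\<bar>exp z - 1\<bar> \<le> \<bar>z\<bar> * exp \<bar>z\<bar>"
  proof (cases "z \<ge> 0")
    case True
    have "exp z - 1 \<le> z * exp z"
      using * by (simp add: algebra_simps)
    then show ?thesis using True by simp
  next
    case False
    have "1 + z \<le> exp z" "exp z \<le> 1" using False by auto
    then have "\<bar>exp z - 1\<bar> \<le> \<bar>z\<bar> * 1" using False by linarith
    also have "\<dots> \<le> \<bar>z\<bar> * exp \<bar>z\<bar>" by (intro mult_left_mono) auto
    finally show ?thesis .
  qed
  have "\<bar>exp z - 1 - z\<bar> = exp z - 1 - z" using exp_ge_add_one_self[of z] by linarith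
  also have "\<dots> \<le> \<bar>z\<bar> * \<bar>exp z - 1\<bar>"
    using * by (metis abs_ge_self abs_mult order_trans)
  also have "\<dots> \<le> \<bar>z\<bar> * (\<bar>z\<bar> * exp \<bar>z\<bar>)"
    by (intro mult_left_mono **) simp
  finally show ?thesis by (simp add: power2_eq_square)
qed

text \<open>The restriction |h| < s/2 gives up half of the exponential decay: it absorbs the factor
  exp(|h| t) of the Taylor remainder and leaves exp(-(s/2) t) to make the bound integrable.\<close>

lemma exp_quadratic_remainder:
  fixes s h t :: real
  assumes "\<bar>h\<bar> < s / 2" "t > 0"
  shows "\<bar>exp (- (s + h) * t) - exp (- s * t) + h * t * exp (- s * t)\<bar>
    \<le> h\<^sup>2 * (t\<^sup>2 * exp (- (s / 2) * t))"
proof -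
  have "exp (- (s + h) * t) - exp (- s * t) + h * t * exp (- s * t)
      = exp (- s * t) * (exp (- h * t) - 1 - (- h * t))"
    by (simp add: algebra_simps flip: exp_add)
  also have "\<bar>\<dots>\<bar> \<le> exp (- s * t) * ((- h * t)\<^sup>2 * exp \<bar>- h * t\<bar>)"
    unfolding abs_mult[of "exp (- s * t)"] using abs_exp_minus_affine_le[of "- h * t"]
    by (intro mult_mono) auto
  also have "\<dots> = h\<^sup>2 * (t\<^sup>2 * exp (\<bar>h\<bar> * t - s * t))"
    using assms by (simp add: power_mult_distrib abs_mult exp_diff exp_minus field_simps)
  also have "\<dots> \<le> h\<^sup>2 * (t\<^sup>2 * exp (- (s / 2) * t))"
  proof -
    have "\<bar>h\<bar> * t \<le> s / 2 * t" using assms by (intro mult_right_mono) auto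
    then have "\<bar>h\<bar> * t - s * t \<le> - (s / 2) * t" by (simp add: field_simps)
    then show ?thesis by (intro mult_left_mono) auto
  qed
  finally show ?thesis .
qed

section \<open>Levy measures and their Laplace transforms\<close>

locale levy_measure =
  fixes \<mu> :: "real measure"
  assumes sets_levy: "sets \<mu> = sets (restrict_space borel {0<..})"
    and levy_finite: "(\<integral>\<^sup>+ t. ennreal (min 1 t) \<partial>\<mu>) < \<infinity>"
begin

lemma space_levy: "space \<mu> = {0<..}"
  using sets_eq_imp_space_eq[OF sets_levy] by (simp add: space_restrict_space)

lemma measurable_levy:
  assumes "g \<in> borel_measurable borel"
  shows "g \<in> borel_measurable \<mu>"
  using measurable_restrict_space1[OF assms, of "{0<..}"] measurable_cong_sets[OF sets_levy refl]
  by blast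

lemma integrable_min: "integrable \<mu> (min 1)"
proof (rule integrableI_bounded)
  show "min 1 \<in> borel_measurable \<mu>" by (rule measurable_levy) simp
  have "(\<integral>\<^sup>+ t. ennreal (norm (min 1 t)) \<partial>\<mu>) = (\<integral>\<^sup>+ t. ennreal (min 1 t) \<partial>\<mu>)"
    by (rule nn_integral_cong) (simp add: space_levy)
  then show "(\<integral>\<^sup>+ t. ennreal (norm (min 1 t)) \<partial>\<mu>) < \<infinity>" using levy_finite by simp
qed

lemma
  fixes g :: "real \<Rightarrow> real"
  assumes g: "g \<in> borel_measurable borel" and bd: "\<And>t. t > 0 \<Longrightarrow> \<bar>g t\<bar> \<le> C * min 1 t"
  shows levy_integrable: "integrable \<mu> g"
    and levy_integral_bound: "\<bar>\<integral>t. g t \<partial>\<mu>\<bar> \<le> C * (\<integral>t. min 1 t \<partial>\<mu>)"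
proof -
  show i: "integrable \<mu> g"
  proof (rule Bochner_Integration.integrable_bound)
    show "integrable \<mu> (\<lambda>t. C * min 1 t)" using integrable_min by simp
    show "AE t in \<mu>. norm (g t) \<le> norm (C * min 1 t)"
    proof (rule AE_I2)
      fix t assume "t \<in> space \<mu>"
      then have "\<bar>g t\<bar> \<le> C * min 1 t" using bd by (simp add: space_levy)
      then show "norm (g t) \<le> norm (C * min 1 t)" by simp
    qed
  qed (rule measurable_levy[OF g])
  have "\<bar>\<integral>t. g t \<partial>\<mu>\<bar> \<le> (\<integral>t. \<bar>g t\<bar> \<partial>\<mu>)" by (rule integral_abs_bound)
  also have "\<dots> \<le> (\<integral>t. C * min 1 t \<partial>\<mu>)"
    by (rule integral_mono) (use i integrable_min bd in \<open>auto simp: space_levy\<close>)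
  finally show "\<bar>\<integral>t. g t \<partial>\<mu>\<bar> \<le> C * (\<integral>t. min 1 t \<partial>\<mu>)" by simp
qed

text \<open>Up to the sign (-1)^n, the n-th derivative of the Laplace transform of \<mu>. For n = 0
  the integral may diverge, because \<mu> may have infinite mass near 0; this is why bounds and
  derivatives are stated for \<open>Suc n\<close>.\<close>

definition laplace :: "nat \<Rightarrow> real \<Rightarrow> real" where
  "laplace n s = (\<integral>t. t ^ n * exp (- s * t) \<partial>\<mu>)"

lemma
  assumes "s > 0"
  shows laplace_integrable: "integrable \<mu> (\<lambda>t. t ^ Suc n * exp (- s * t))"
    and laplace_bound:
      "\<bar>laplace (Suc n) s\<bar> \<le> (1 + fact (Suc n) * inverse s ^ Suc n) * (\<integral>t. min 1 t \<partial>\<mu>)"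
proof -
  have bd: "\<bar>t ^ Suc n * exp (- s * t)\<bar> \<le> (1 + fact (Suc n) * inverse s ^ Suc n) * min 1 t"
    if "t > 0" for t
    using power_mult_exp_le[OF assms that, of n] that by (simp add: abs_mult del: fact_Suc)
  show "integrable \<mu> (\<lambda>t. t ^ Suc n * exp (- s * t))"
    by (rule levy_integrable[OF _ bd]) auto
  show "\<bar>laplace (Suc n) s\<bar> \<le> (1 + fact (Suc n) * inverse s ^ Suc n) * (\<integral>t. min 1 t \<partial>\<mu>)"
    unfolding laplace_def by (rule levy_integral_bound[OF _ bd]) auto
qed

lemma integral_min_nonneg: "0 \<le> (\<integral>t. min 1 t \<partial>\<mu>)"
  by (rule integral_nonneg_AE) (auto simp: space_levy)

lemma moderate_growth_laplace: "moderate_growth (laplace (Suc n))"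
proof (rule moderate_growthI)
  fix s :: real assume s: "s > 0"
  have "1 + fact (Suc n) * inverse s ^ Suc n \<le> (1 + fact (Suc n)) * pole_weight s ^ Suc n"
    unfolding distrib_right using pole_weight_ge_1[OF s] pole_weight_ge(2)[OF s] s
    by (intro add_mono mult_left_mono power_mono) (auto simp del: power_Suc)
  then have "(1 + fact (Suc n) * inverse s ^ Suc n) * (\<integral>t. min 1 t \<partial>\<mu>)
      \<le> (1 + fact (Suc n)) * pole_weight s ^ Suc n * (\<integral>t. min 1 t \<partial>\<mu>)"
    by (rule mult_right_mono[OF _ integral_min_nonneg])
  then show "\<bar>laplace (Suc n) s\<bar> \<le> ((1 + fact (Suc n)) * (\<integral>t. min 1 t \<partial>\<mu>)) * pole_weight s ^ Suc n"
    using laplace_bound[OF s, of n] by (simp add: ac_simps del: power_Suc fact_Suc)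
qed

lemma DERIV_laplace:
  assumes s: "s > 0"
  shows "(laplace (Suc n) has_real_derivative (- 1) * laplace (Suc (Suc n)) s) (at s)"
proof -
  have "((\<lambda>s. \<integral>t. t ^ Suc n * exp (- s * t) \<partial>\<mu>) has_derivative
      (\<lambda>h. \<integral>t. h * - (t ^ Suc (Suc n) * exp (- s * t)) \<partial>\<mu>)) (at s)"
  proof (rule has_derivative_integral_of_quadratic_remainder)
    show "s / 2 > 0" using s by simp
    show "integrable \<mu> (\<lambda>t. t ^ Suc n * exp (- (s + h) * t))" if "norm h < s / 2" for h
      using that s by (intro laplace_integrable) (auto simp: abs_less_iff)
    have "(\<lambda>h. \<integral>t. h * - (t ^ Suc (Suc n) * exp (- s * t)) \<partial>\<mu>)
        = (\<lambda>h. h * - laplace (Suc (Suc n)) s)"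
      by (simp add: laplace_def del: power_Suc)
    then show "bounded_linear (\<lambda>h. \<integral>t. h * - (t ^ Suc (Suc n) * exp (- s * t)) \<partial>\<mu>)"
      by (simp only: bounded_linear_mult_left)
    show "integrable \<mu> (\<lambda>t. h * - (t ^ Suc (Suc n) * exp (- s * t)))" for h
      using laplace_integrable[OF s, of "Suc n"]
      by (intro integrable_mult_right Bochner_Integration.integrable_minus)
    \<comment> \<open>The remainder costs a factor t^2 and half of the decay, hence the Laplace
      integrand of order n + 3 at s/2.\<close>
    show "integrable \<mu> (\<lambda>t. t ^ Suc (Suc (Suc n)) * exp (- (s / 2) * t))"
      using s by (intro laplace_integrable) auto
    fix h t :: real assume h: "norm h < s / 2" and "t \<in> space \<mu>"
    then have t: "t > 0" by (simp add: space_levy)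
    have "t ^ Suc n * exp (- (s + h) * t) - t ^ Suc n * exp (- s * t)
          - h * - (t ^ Suc (Suc n) * exp (- s * t))
        = t ^ Suc n * (exp (- (s + h) * t) - exp (- s * t) + h * t * exp (- s * t))"
      by (simp add: algebra_simps)
    also have "norm \<dots> \<le> t ^ Suc n * (h\<^sup>2 * (t\<^sup>2 * exp (- (s / 2) * t)))"
      unfolding real_norm_def abs_mult
      using exp_quadratic_remainder[of h s t] h t by (intro mult_mono) (auto simp: abs_mult)
    also have "\<dots> = (norm h)\<^sup>2 * (t ^ Suc (Suc (Suc n)) * exp (- (s / 2) * t))"
      by (simp add: power2_eq_square)
    finally show "norm (t ^ Suc n * exp (- (s + h) * t) - t ^ Suc n * exp (- s * t)
          - h * - (t ^ Suc (Suc n) * exp (- s * t)))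
        \<le> (norm h)\<^sup>2 * (t ^ Suc (Suc (Suc n)) * exp (- (s / 2) * t))" .
  qed
  then show ?thesis
    unfolding has_field_derivative_def laplace_def[abs_def]
    by (rule has_derivative_eq_rhs) (auto simp: fun_eq_iff simp del: power_Suc)
qed

lemma moderate_laplace: "moderate n (laplace (Suc m))"
proof (induction n arbitrary: m)
  case 0
  then show ?case by (simp add: moderate_growth_laplace)
next
  case (Suc n)
  show ?case
    by (rule moderate_SucI[OF moderate_growth_laplace DERIV_laplace moderate_mult[OF moderate_const Suc]])
qed

lemma abs_one_minus_exp_le:
  fixes s t :: real
  assumes "s > 0" "t > 0"
  shows "\<bar>1 - exp (- s * t)\<bar> \<le> pole_weight s * min 1 t"
proof -
  have "1 - exp (- s * t) \<le> s * t" using exp_ge_add_one_self[of "- s * t"] by simp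
  also have "\<dots> \<le> pole_weight s * t" using pole_weight_ge(1) assms by (intro mult_right_mono) auto
  finally have "1 - exp (- s * t) \<le> pole_weight s * t" .
  moreover have "1 - exp (- s * t) \<le> pole_weight s * 1"
    using pole_weight_ge_1[OF assms(1)] exp_gt_zero[of "- s * t"] by linarith
  ultimately have "1 - exp (- s * t) \<le> pole_weight s * min 1 t" by (simp add: min_def)
  then show ?thesis using assms by simp
qed

definition levy_part :: "real \<Rightarrow> real" where
  "levy_part s = (\<integral>t. 1 - exp (- s * t) \<partial>\<mu>)"

lemma moderate_growth_levy_part: "moderate_growth levy_part"
proof (rule moderate_growthI)
  fix s :: real assume s: "s > 0"
  have "\<bar>levy_part s\<bar> \<le> pole_weight s * (\<integral>t. min 1 t \<partial>\<mu>)"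
    unfolding levy_part_def by (rule levy_integral_bound) (use abs_one_minus_exp_le[OF s] in auto)
  then show "\<bar>levy_part s\<bar> \<le> (\<integral>t. min 1 t \<partial>\<mu>) * pole_weight s ^ 1" by (simp add: ac_simps)
qed

lemma DERIV_levy_part:
  assumes s: "s > 0"
  shows "(levy_part has_real_derivative laplace 1 s) (at s)"
proof -
  have "((\<lambda>s. \<integral>t. 1 - exp (- s * t) \<partial>\<mu>) has_derivative
      (\<lambda>h. \<integral>t. h * (t ^ Suc 0 * exp (- s * t)) \<partial>\<mu>)) (at s)"
  proof (rule has_derivative_integral_of_quadratic_remainder)
    show "s / 2 > 0" using s by simp
    show "integrable \<mu> (\<lambda>t. 1 - exp (- (s + h) * t))" if "norm h < s / 2" for h :: real
    proof -
      have "s + h > 0" using that s by (auto simp: abs_less_iff)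
      then show ?thesis by (intro levy_integrable) (use abs_one_minus_exp_le[of "s + h"] in auto)
    qed
    have "(\<lambda>h. \<integral>t. h * (t ^ Suc 0 * exp (- s * t)) \<partial>\<mu>) = (\<lambda>h. h * laplace (Suc 0) s)"
      by (simp add: laplace_def del: power_Suc)
    then show "bounded_linear (\<lambda>h. \<integral>t. h * (t ^ Suc 0 * exp (- s * t)) \<partial>\<mu>)"
      by (simp only: bounded_linear_mult_left)
    show "integrable \<mu> (\<lambda>t. h * (t ^ Suc 0 * exp (- s * t)))" for h
      using laplace_integrable[OF s, of 0] by (intro integrable_mult_right)
    show "integrable \<mu> (\<lambda>t. t ^ Suc (Suc 0) * exp (- (s / 2) * t))"
      using s by (intro laplace_integrable) auto
    fix h t :: real assume h: "norm h < s / 2" and "t \<in> space \<mu>"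
    then have t: "t > 0" by (simp add: space_levy)
    have "norm (1 - exp (- (s + h) * t) - (1 - exp (- s * t)) - h * (t ^ Suc 0 * exp (- s * t)))
        = \<bar>exp (- (s + h) * t) - exp (- s * t) + h * t * exp (- s * t)\<bar>"
      unfolding real_norm_def by (subst abs_minus_cancel[symmetric]) (simp add: algebra_simps)
    also have "\<dots> \<le> (norm h)\<^sup>2 * (t ^ Suc (Suc 0) * exp (- (s / 2) * t))"
      using exp_quadratic_remainder[of h s t] h t by (simp add: power2_eq_square)
    finally show "norm (1 - exp (- (s + h) * t) - (1 - exp (- s * t)) - h * (t ^ Suc 0 * exp (- s * t)))
        \<le> (norm h)\<^sup>2 * (t ^ Suc (Suc 0) * exp (- (s / 2) * t))" .
  qed
  then show ?thesis
    unfolding has_field_derivative_def levy_part_def[abs_def] laplace_def[abs_def]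
    by (simp add: mult.commute[of _ "integral\<^sup>L \<mu> _"])
qed

lemma moderate_levy_part: "moderate n levy_part"
proof (cases n)
  case 0
  then show ?thesis by (simp add: moderate_growth_levy_part)
next
  case (Suc m)
  have "moderate (Suc m) levy_part"
    by (rule moderate_SucI[OF moderate_growth_levy_part DERIV_levy_part])
      (use moderate_laplace[of m 0] in auto)
  then show ?thesis using Suc by simp
qed

lemma laplace_nonneg: "0 \<le> laplace n s"
  unfolding laplace_def by (rule integral_nonneg_AE) (auto simp: space_levy)

lemma laplace_antimono:
  assumes "0 < s" "s \<le> r"
  shows "laplace 1 r \<le> laplace 1 s"
  unfolding laplace_def
proof (rule integral_mono)
  show "integrable \<mu> (\<lambda>t. t ^ 1 * exp (- r * t))" "integrable \<mu> (\<lambda>t. t ^ 1 * exp (- s * t))"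
    using laplace_integrable[of r 0] laplace_integrable[of s 0] assms by auto
  show "t ^ 1 * exp (- r * t) \<le> t ^ 1 * exp (- s * t)" if "t \<in> space \<mu>" for t
    using that assms by (auto simp: space_levy intro!: mult_left_mono mult_right_mono)
qed

text \<open>A vanishing integral of the strictly positive function t e^(-s t) forces \<mu> to be the
  null measure, and then every other integral against it vanishes as well.\<close>

lemma levy_part_eq_0:
  assumes "laplace 1 s = 0" "s > 0"
  shows "levy_part r = 0"
proof -
  have "AE t in \<mu>. t ^ 1 * exp (- s * t) = 0"
    using assms laplace_integrable[of s 0] unfolding laplace_def
    by (subst (asm) integral_nonneg_eq_0_iff_AE) (auto simp: space_levy)
  then have "AE t in \<mu>. False"
    by (rule AE_mp) (auto intro!: AE_I2 simp: space_levy)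
  then have "AE t in \<mu>. 1 - exp (- r * t) = 0" by (rule AE_mp) auto
  then show ?thesis
    unfolding levy_part_def by (rule integral_eq_zero_AE)
qed

end

text \<open>The divided difference is \<open>h(s) = \<integral>\<^sub>0\<^sup>1 f'(1 + t(s - 1)) dt\<close>. As \<open>f'\<close> is decreasing, the integrand
  is at least \<open>f'(2) > 0\<close> for \<open>0 \<le> t \<le> 1 / (s + 1/s)\<close>, so \<open>1/h\<close> has moderate growth.\<close>

lemma bernstein_divided_difference:
  assumes "bernstein_function f" "\<not> f constant_on {0<..}"
  obtains h where "\<And>s. s > 0 \<Longrightarrow> f s - f 1 = (s - 1) * h s" "\<And>s. s > 0 \<Longrightarrow> h s \<noteq> 0"
    "\<And>n. moderate n h" "\<And>n. moderate n (\<lambda>s. inverse (h s))" "\<And>n. moderate n f"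
proof -
  obtain a b \<mu> where ab: "0 \<le> a" "0 \<le> b" and \<mu>: "sets \<mu> = sets (restrict_space borel {0<..})"
      "(\<integral>\<^sup>+ t. ennreal (min 1 t) \<partial>\<mu>) < \<infinity>"
    and f: "\<And>s. s > 0 \<Longrightarrow> f s = a + b * s + (LINT t|\<mu>. 1 - exp (- s * t))"
    using assms(1) unfolding bernstein_function_def levy_triple_def by blast
  interpret levy_measure \<mu> using \<mu> by unfold_locales
  have f': "f s = a + b * s + levy_part s" if "s > 0" for s
    using f[OF that] by (simp add: levy_part_def)
  \<comment> \<open>\<open>d\<close> is f' on the positive half-line: the constant \<open>a\<close>
    disappears and the Levy part contributes the integral of t e^(-s t).\<close>
  define d where "d s = b + laplace 1 s" for s
  have df: "(f has_real_derivative d s) (at s)" if "s > 0" for s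
  proof -
    have "((\<lambda>s. a + b * s + levy_part s) has_real_derivative d s) (at s)"
      unfolding d_def using DERIV_levy_part[OF that] by (auto intro!: derivative_eq_intros)
    then show ?thesis
      by (rule has_field_derivative_transform_within_open[of _ _ _ "{0<..}"]) (use that f' in auto)
  qed
  have modd: "moderate n d" for n
    unfolding d_def[abs_def] using moderate_laplace[of n 0]
    by (intro moderate_add moderate_const) auto
  have grf: "moderate_growth f"
  proof -
    have "moderate 0 (\<lambda>s. a + b * s + levy_part s)"
      by (intro moderate_add moderate_mult moderate_const moderate_ident moderate_levy_part)
    then show ?thesis using f' by (simp add: moderate_growth_def)
  qed
  have modf: "moderate n f" for n
  proof (cases n)
    case 0
    then show ?thesis using grf by simp
  next
    case (Suc m)
    have "moderate (Suc m) f" by (rule moderate_SucI[OF grf df modd])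
    then show ?thesis using Suc by simp
  qed
  have d_nonneg: "0 \<le> d s" for s
    unfolding d_def using ab(2) laplace_nonneg[of 1 s] by simp
  have d_anti: "d 2 \<le> d s" if "0 < s" "s \<le> 2" for s
    unfolding d_def using laplace_antimono[OF that] by simp
  \<comment> \<open>Non-constancy enters here: f'(2) = 0 would kill both \<open>b\<close> and \<mu>,
    leaving f = a for all positive arguments.\<close>
  have d2: "d 2 > 0"
  proof (rule ccontr)
    assume "\<not> d 2 > 0"
    then have "b = 0" "laplace 1 2 = 0"
      using ab(2) laplace_nonneg[of 1 2] unfolding d_def by linarith+
    then have "f s = a" if "s > 0" for s
      using f'[OF that] levy_part_eq_0[of 2 s] by simp
    then have "f constant_on {0<..}" unfolding constant_on_def by auto
    then show False using assms(2) by blast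
  qed
  \<comment> \<open>The factor \<open>t ^ 0\<close> keeps the integrand in the shape of the segment
    lemmas, with k = 0.\<close>
  define h where "h s = integral {0..1} (\<lambda>t. t ^ 0 * d (1 + t * (s - 1)))" for s
  have modh: "moderate n h" for n
    unfolding h_def[abs_def] by (rule moderate_segment_integral[OF modd])
  have contd: "continuous_on {0<..} d"
    using moderate_continuous_on[OF modd] .
  have hf: "f s - f 1 = (s - 1) * h s" if s: "s > 0" for s
  proof -
    have "((\<lambda>t. (s - 1) * (t ^ 0 * d (1 + t * (s - 1)))) has_integral
        f (1 + 1 * (s - 1)) - f (1 + 0 * (s - 1))) {0..1}"
    proof (rule fundamental_theorem_of_calculus)
      fix t :: real assume t: "t \<in> {0..1}"
      then have pos: "1 + t * (s - 1) > 0" using pole_weight_between(1)[OF s, of t] by simp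
      have "((\<lambda>t. 1 + t * (s - 1)) has_real_derivative s - 1) (at t within {0..1})"
        by (auto intro!: derivative_eq_intros)
      from DERIV_chain2[OF df[OF pos] this]
      show "((\<lambda>t. f (1 + t * (s - 1))) has_vector_derivative
          (s - 1) * (t ^ 0 * d (1 + t * (s - 1)))) (at t within {0..1})"
        by (simp add: has_real_derivative_iff_has_vector_derivative mult.commute)
    qed simp
    from integral_unique[OF this] show ?thesis by (simp add: h_def)
  qed
  have h_low: "inverse (pole_weight s) * d 2 \<le> h s" if s: "s > 0" for s
  proof -
    let ?c = "inverse (pole_weight s)"
    have c: "0 < ?c" "?c \<le> 1" using pole_weight_ge_1[OF s] by (auto simp: inverse_le_1_iff)
    have int: "(\<lambda>t. t ^ 0 * d (1 + t * (s - 1))) integrable_on {0..1}"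
      by (intro integrable_continuous_real continuous_on_segment contd s)
    have int': "(\<lambda>t. t ^ 0 * d (1 + t * (s - 1))) integrable_on {0..?c}"
      by (rule integrable_subinterval_real[OF int]) (use c in auto)
    have "?c * d 2 = integral {0..?c} (\<lambda>t. d 2)" using c by simp
    also have "\<dots> \<le> integral {0..?c} (\<lambda>t. t ^ 0 * d (1 + t * (s - 1)))"
    proof (rule integral_le)
      fix t assume t: "t \<in> {0..?c}"
      \<comment> \<open>The bound \<open>?c\<close> on \<open>t\<close> is chosen for t s \<le> 1;
        then 1 - t + t s is at most 2, within the range of \<open>d_anti\<close>.\<close>
      have "t * s \<le> ?c * pole_weight s" using t s pole_weight_ge(1)[OF s] by (intro mult_mono) auto
      then have "t * s \<le> 1" using pole_weight_ge_1[OF s] by simp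
      then have "1 + t * (s - 1) \<le> 2" using t by (simp add: algebra_simps)
      moreover have "1 + t * (s - 1) > 0" using pole_weight_between(1)[OF s, of t] t c by simp
      ultimately show "d 2 \<le> t ^ 0 * d (1 + t * (s - 1))" using d_anti by simp
    qed (use int' in auto)
    also have "\<dots> \<le> h s" unfolding h_def
      by (rule integral_subset_le) (use int int' c d_nonneg in auto)
    finally show ?thesis .
  qed
  have h_pos: "h s > 0" if "s > 0" for s
    using h_low[OF that] d2 pole_weight_ge_1[OF that] by (smt (verit) mult_pos_pos positive_imp_inverse_positive)
  have "moderate_growth (\<lambda>s. inverse (h s))"
  proof (rule moderate_growthI)
    fix s :: real assume s: "s > 0"
    have "inverse (h s) \<le> inverse (inverse (pole_weight s) * d 2)"
      using h_low[OF s] d2 pole_weight_ge_1[OF s] by (intro le_imp_inverse_le) auto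
    then show "\<bar>inverse (h s)\<bar> \<le> inverse (d 2) * pole_weight s ^ 1"
      using h_pos[OF s] by (simp add: ac_simps)
  qed
  then have "moderate n (\<lambda>s. inverse (h s))" for n
    using h_pos by (intro moderate_inverse modh) (auto simp: less_imp_neq[symmetric])
  then show ?thesis
    using that[of h] hf h_pos modh modf by (metis less_numeral_extra(3))
qed


section \<open>Schwartz functions\<close>

text \<open>The gradient is explicit data here, so that derivative rules can be stated for known
  candidates. The choice made by \<open>frechet_derivative\<close>, on which \<open>pderivs\<close>
  rests, is met only in \<open>has_grad_pderivs\<close> and \<open>has_grad_unique\<close>.\<close>

definition has_grad :: "(real ^ 'd \<Rightarrow> complex) \<Rightarrow> ('d \<Rightarrow> real ^ 'd \<Rightarrow> complex) \<Rightarrow> bool" where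
  "has_grad \<phi> \<phi>' \<longleftrightarrow> (\<forall>x. (\<phi> has_derivative (\<lambda>h. \<Sum>j\<in>UNIV. h $ j *\<^sub>R \<phi>' j x)) (at x))"

lemma has_gradD:
  "has_grad \<phi> \<phi>' \<Longrightarrow> (\<phi> has_derivative (\<lambda>h. \<Sum>j\<in>UNIV. h $ j *\<^sub>R \<phi>' j x)) (at x)"
  by (simp add: has_grad_def)

lemma has_grad_pderivs:
  assumes "\<phi> differentiable_on UNIV"
  shows "has_grad \<phi> (\<lambda>j. pderivs [j] \<phi>)"
  unfolding has_grad_def
proof
  fix x
  let ?D = "frechet_derivative \<phi> (at x)"
  have D: "(\<phi> has_derivative ?D) (at x)"
    using assms by (simp add: differentiable_on_def frechet_derivative_works[symmetric])
  then have lin: "linear ?D" by (rule has_derivative_linear)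
  have *: "?D h = (\<Sum>j\<in>UNIV. h $ j *\<^sub>R pderivs [j] \<phi> x)" for h
  proof -
    have "?D h = ?D (\<Sum>j\<in>UNIV. h $ j *\<^sub>R axis j 1)"
      using basis_expansion[of h] by (simp add: scalar_mult_eq_scaleR)
    also have "\<dots> = (\<Sum>j\<in>UNIV. h $ j *\<^sub>R ?D (axis j 1))"
      by (simp add: linear_sum[OF lin] linear_cmul[OF lin])
    finally show ?thesis by simp
  qed
  from D show "(\<phi> has_derivative (\<lambda>h. \<Sum>j\<in>UNIV. h $ j *\<^sub>R pderivs [j] \<phi> x)) (at x)"
    by (rule has_derivative_eq_rhs) (rule ext, rule *)
qed

text \<open>The way back from the derivative rules to \<open>pderivs\<close>: the Frechet derivative
  is unique, and \<open>axis j 1\<close> selects one summand of it.\<close>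

lemma has_grad_unique:
  assumes "has_grad \<phi> \<phi>'"
  shows "pderivs [j] \<phi> = \<phi>' j"
proof
  fix x
  have "frechet_derivative \<phi> (at x) = (\<lambda>h. \<Sum>j\<in>UNIV. h $ j *\<^sub>R \<phi>' j x)"
    using frechet_derivative_at[OF has_gradD[OF assms]] by simp
  moreover have "(\<Sum>i\<in>UNIV. axis j (1::real) $ i *\<^sub>R \<phi>' i x) = (\<Sum>i\<in>UNIV. if i = j then \<phi>' i x else 0)"
    by (rule sum.cong) (auto simp: axis_def)
  ultimately show "pderivs [j] \<phi> x = \<phi>' j x" by simp
qed

lemma has_grad_differentiable: "has_grad \<phi> \<phi>' \<Longrightarrow> \<phi> differentiable_on UNIV"
  unfolding has_grad_def differentiable_on_def differentiable_def by auto

lemma has_grad_continuous: "has_grad \<phi> \<phi>' \<Longrightarrow> continuous_on UNIV \<phi>"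
  by (blast dest: has_grad_differentiable differentiable_imp_continuous_on)

lemma has_grad_add:
  "has_grad \<phi> \<phi>' \<Longrightarrow> has_grad \<psi> \<psi>' \<Longrightarrow> has_grad (\<lambda>x. \<phi> x + \<psi> x) (\<lambda>j x. \<phi>' j x + \<psi>' j x)"
  unfolding has_grad_def scaleR_add_right sum.distrib by (intro allI has_derivative_add) blast+

lemma has_grad_cmult: "has_grad \<phi> \<phi>' \<Longrightarrow> has_grad (\<lambda>x. c * \<phi> x) (\<lambda>j x. c * \<phi>' j x)"
  unfolding has_grad_def
proof
  fix x assume "\<forall>x. (\<phi> has_derivative (\<lambda>h. \<Sum>j\<in>UNIV. h $ j *\<^sub>R \<phi>' j x)) (at x)"
  then have "((\<lambda>x. c * \<phi> x) has_derivative (\<lambda>h. c * (\<Sum>j\<in>UNIV. h $ j *\<^sub>R \<phi>' j x))) (at x)"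
    by (intro has_derivative_mult_right) auto
  then show "((\<lambda>x. c * \<phi> x) has_derivative (\<lambda>h. \<Sum>j\<in>UNIV. h $ j *\<^sub>R (c * \<phi>' j x))) (at x)"
    by (simp add: sum_distrib_left)
qed

lemma has_grad_coord:
  assumes "has_grad \<phi> \<phi>'"
  shows "has_grad (\<lambda>x. x $ i *\<^sub>R \<phi> x) (\<lambda>j x. (if j = i then \<phi> x else 0) + x $ i *\<^sub>R \<phi>' j x)"
  unfolding has_grad_def
proof
  fix x
  have "((\<lambda>x. x $ i *\<^sub>R \<phi> x) has_derivative
      (\<lambda>h. x $ i *\<^sub>R (\<Sum>j\<in>UNIV. h $ j *\<^sub>R \<phi>' j x) + h $ i *\<^sub>R \<phi> x)) (at x)"
    by (intro has_derivative_scaleR has_gradD[OF assms] bounded_linear_imp_has_derivative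
        bounded_linear_vec_nth)
  moreover have "(\<Sum>j\<in>UNIV. h $ j *\<^sub>R ((if j = i then \<phi> x else 0) + x $ i *\<^sub>R \<phi>' j x))
      = x $ i *\<^sub>R (\<Sum>j\<in>UNIV. h $ j *\<^sub>R \<phi>' j x) + h $ i *\<^sub>R \<phi> x" for h
  proof -
    have "(\<Sum>j\<in>UNIV. h $ j *\<^sub>R (if j = i then \<phi> x else 0))
        = (\<Sum>j\<in>UNIV. if j = i then h $ j *\<^sub>R \<phi> x else 0)"
      by (rule sum.cong) auto
    then have "(\<Sum>j\<in>UNIV. h $ j *\<^sub>R (if j = i then \<phi> x else 0)) = h $ i *\<^sub>R \<phi> x" by simp
    then show ?thesis
      by (simp add: scaleR_add_right sum.distrib scaleR_sum_right mult.commute)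
  qed
  ultimately show "((\<lambda>x. x $ i *\<^sub>R \<phi> x) has_derivative
      (\<lambda>h. \<Sum>j\<in>UNIV. h $ j *\<^sub>R ((if j = i then \<phi> x else 0) + x $ i *\<^sub>R \<phi>' j x))) (at x)"
    by simp
qed

lemma has_grad_reflect:
  assumes "has_grad \<phi> \<phi>'"
  shows "has_grad (\<lambda>x. \<phi> (- x)) (\<lambda>j x. - \<phi>' j (- x))"
  unfolding has_grad_def
proof
  fix x
  have "((\<lambda>x. \<phi> (- x)) has_derivative (\<lambda>h. \<Sum>j\<in>UNIV. (- h) $ j *\<^sub>R \<phi>' j (- x))) (at x)"
    by (rule has_derivative_compose[where g = \<phi>]) (auto intro!: derivative_intros has_gradD[OF assms])
  then show "((\<lambda>x. \<phi> (- x)) has_derivative (\<lambda>h. \<Sum>j\<in>UNIV. h $ j *\<^sub>R - \<phi>' j (- x))) (at x)"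
    by simp
qed

definition rapid_decay :: "(real ^ 'd \<Rightarrow> complex) \<Rightarrow> bool" where
  "rapid_decay \<phi> \<longleftrightarrow> (\<forall>k. \<exists>C. \<forall>x. (1 + norm x) ^ k * norm (\<phi> x) \<le> C)"

lemma rapid_decayD:
  assumes "rapid_decay \<phi>"
  obtains C where "C \<ge> 0" "\<And>x. (1 + norm x) ^ k * norm (\<phi> x) \<le> C"
proof -
  obtain C where C: "\<And>x. (1 + norm x) ^ k * norm (\<phi> x) \<le> C"
    using assms unfolding rapid_decay_def by blast
  have "0 \<le> (1 + norm (0 :: real ^ 'a)) ^ k * norm (\<phi> 0)" by simp
  then have "C \<ge> 0" using C[of 0] by linarith
  then show thesis using C that by blast
qed

lemma rapid_decay_add:
  assumes "rapid_decay \<phi>" "rapid_decay \<psi>"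
  shows "rapid_decay (\<lambda>x. \<phi> x + \<psi> x)"
  unfolding rapid_decay_def
proof
  fix k
  obtain C D where C: "\<And>x. (1 + norm x) ^ k * norm (\<phi> x) \<le> C"
    and D: "\<And>x. (1 + norm x) ^ k * norm (\<psi> x) \<le> D"
    using assms rapid_decayD by metis
  have "(1 + norm x) ^ k * norm (\<phi> x + \<psi> x) \<le> C + D" for x
  proof -
    have "(1 + norm x) ^ k * norm (\<phi> x + \<psi> x) \<le> (1 + norm x) ^ k * (norm (\<phi> x) + norm (\<psi> x))"
      by (intro mult_left_mono norm_triangle_ineq) simp
    then show ?thesis using C[of x] D[of x] by (simp add: distrib_left)
  qed
  then show "\<exists>C. \<forall>x. (1 + norm x) ^ k * norm (\<phi> x + \<psi> x) \<le> C" by blast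
qed

lemma rapid_decay_cmult:
  assumes "rapid_decay \<phi>"
  shows "rapid_decay (\<lambda>x. c * \<phi> x)"
  unfolding rapid_decay_def
proof
  fix k
  obtain C where C: "\<And>x. (1 + norm x) ^ k * norm (\<phi> x) \<le> C"
    using assms rapid_decayD by metis
  have "(1 + norm x) ^ k * norm (c * \<phi> x) \<le> norm c * C" for x
    using mult_left_mono[OF C[of x], of "norm c"] by (simp add: norm_mult ac_simps)
  then show "\<exists>C. \<forall>x. (1 + norm x) ^ k * norm (c * \<phi> x) \<le> C" by blast
qed

lemma rapid_decay_coord:
  assumes "rapid_decay \<phi>"
  shows "rapid_decay (\<lambda>x. x $ i *\<^sub>R \<phi> x)"
  unfolding rapid_decay_def
proof
  fix k
  obtain C where C: "\<And>x. (1 + norm x) ^ Suc k * norm (\<phi> x) \<le> C"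
    using assms rapid_decayD by metis
  have "(1 + norm x) ^ k * norm (x $ i *\<^sub>R \<phi> x) \<le> C" for x
  proof -
    have "\<bar>x $ i\<bar> \<le> 1 + norm x" using component_le_norm_cart[of x i] by linarith
    then have "(1 + norm x) ^ k * norm (x $ i *\<^sub>R \<phi> x)
        \<le> (1 + norm x) ^ k * ((1 + norm x) * norm (\<phi> x))"
      by (auto intro!: mult_left_mono mult_right_mono)
    then show ?thesis using C[of x] by (simp add: ac_simps)
  qed
  then show "\<exists>C. \<forall>x. (1 + norm x) ^ k * norm (x $ i *\<^sub>R \<phi> x) \<le> C" by blast
qed

lemma rapid_decay_reflect: "rapid_decay \<phi> \<Longrightarrow> rapid_decay (\<lambda>x. \<phi> (- x))"
  unfolding rapid_decay_def by (metis norm_minus_cancel)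

lemma schwartz_iff:
  "\<phi> \<in> schwartz \<longleftrightarrow> (\<forall>is. pderivs is \<phi> differentiable_on UNIV \<and> rapid_decay (pderivs is \<phi>))"
  unfolding schwartz_def smooth_def rapid_decay_def bdd_above_def by auto

lemma pderivs_append: "pderivs (xs @ ys) \<phi> = pderivs xs (pderivs ys \<phi>)"
  by (induction xs) auto

lemma schwartzD:
  assumes "\<phi> \<in> schwartz"
  shows schwartz_rapid_decay: "rapid_decay \<phi>"
    and schwartz_has_grad: "has_grad \<phi> (\<lambda>j. pderivs [j] \<phi>)"
    and schwartz_pderivs: "pderivs is \<phi> \<in> schwartz"
proof -
  have *: "pderivs is \<phi> differentiable_on UNIV" "rapid_decay (pderivs is \<phi>)" for "is"
    using assms by (auto simp: schwartz_iff)
  show "rapid_decay \<phi>" using *(2)[of "[]"] by simp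
  show "has_grad \<phi> (\<lambda>j. pderivs [j] \<phi>)" using *(1)[of "[]"] by (intro has_grad_pderivs) simp
  show "pderivs is \<phi> \<in> schwartz" unfolding schwartz_iff pderivs_append[symmetric] using * by blast
qed

lemma pderivs_mem:
  assumes "\<phi> \<in> A" and "\<And>\<phi>. \<phi> \<in> A \<Longrightarrow> \<exists>\<phi>'. has_grad \<phi> \<phi>' \<and> (\<forall>j. \<phi>' j \<in> A)"
  shows "pderivs is \<phi> \<in> A"
proof (induction "is")
  case Nil
  then show ?case using assms(1) by simp
next
  case (Cons i "is")
  obtain \<phi>' where \<phi>': "has_grad (pderivs is \<phi>) \<phi>'" "\<And>j. \<phi>' j \<in> A"
    using assms(2)[OF Cons] by blast
  have "pderivs (i # is) \<phi> = pderivs [i] (pderivs is \<phi>)" by simp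
  then show ?case using has_grad_unique[OF \<phi>'(1)] \<phi>'(2) by simp
qed

text \<open>Instead of computing higher derivatives one exhibits a set of rapidly decaying functions
  that contains the components of a gradient of each of its members. The applications take for
  \<open>A\<close> all functions of the required shape.\<close>

lemma schwartz_coinduct:
  assumes "\<phi> \<in> A" and "\<And>\<phi>. \<phi> \<in> A \<Longrightarrow> rapid_decay \<phi>"
    and "\<And>\<phi>. \<phi> \<in> A \<Longrightarrow> \<exists>\<phi>'. has_grad \<phi> \<phi>' \<and> (\<forall>j. \<phi>' j \<in> A)"
  shows "\<phi> \<in> schwartz"
  unfolding schwartz_iff
  using pderivs_mem[OF assms(1,3)] assms(2,3) has_grad_differentiable by blast

lemma schwartz_add:
  assumes "\<phi> \<in> schwartz" "\<psi> \<in> schwartz"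
  shows "(\<lambda>x. \<phi> x + \<psi> x) \<in> schwartz"
proof (rule schwartz_coinduct)
  let ?A = "{\<lambda>x. \<phi> x + \<psi> x |\<phi> \<psi>. \<phi> \<in> schwartz \<and> \<psi> \<in> schwartz}"
  show "(\<lambda>x. \<phi> x + \<psi> x) \<in> ?A" using assms by blast
  fix \<eta> assume "\<eta> \<in> ?A"
  then obtain \<phi> \<psi> where *: "\<eta> = (\<lambda>x. \<phi> x + \<psi> x)" "\<phi> \<in> schwartz" "\<psi> \<in> schwartz" by blast
  show "rapid_decay \<eta>" using * rapid_decay_add schwartz_rapid_decay by blast
  have "has_grad \<eta> (\<lambda>j x. pderivs [j] \<phi> x + pderivs [j] \<psi> x)"
    unfolding *(1) by (intro has_grad_add schwartz_has_grad *)
  moreover have "(\<lambda>x. pderivs [j] \<phi> x + pderivs [j] \<psi> x) \<in> ?A" for j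
    using *(2,3) schwartz_pderivs by blast
  ultimately show "\<exists>\<eta>'. has_grad \<eta> \<eta>' \<and> (\<forall>j. \<eta>' j \<in> ?A)" by blast
qed

lemma schwartz_cmult:
  assumes "\<phi> \<in> schwartz"
  shows "(\<lambda>x. c * \<phi> x) \<in> schwartz"
proof (rule schwartz_coinduct)
  let ?A = "{\<lambda>x. c * \<phi> x |\<phi>. \<phi> \<in> schwartz}"
  show "(\<lambda>x. c * \<phi> x) \<in> ?A" using assms by blast
  fix \<eta> assume "\<eta> \<in> ?A"
  then obtain \<phi> where *: "\<eta> = (\<lambda>x. c * \<phi> x)" "\<phi> \<in> schwartz" by blast
  show "rapid_decay \<eta>" using * rapid_decay_cmult schwartz_rapid_decay by blast
  have "has_grad \<eta> (\<lambda>j x. c * pderivs [j] \<phi> x)"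
    unfolding *(1) by (intro has_grad_cmult schwartz_has_grad *)
  moreover have "(\<lambda>x. c * pderivs [j] \<phi> x) \<in> ?A" for j
    using *(2) schwartz_pderivs by blast
  ultimately show "\<exists>\<eta>'. has_grad \<eta> \<eta>' \<and> (\<forall>j. \<eta>' j \<in> ?A)" by blast
qed

lemma schwartz_reflect:
  assumes "\<phi> \<in> schwartz"
  shows "(\<lambda>x. \<phi> (- x)) \<in> schwartz"
proof (rule schwartz_coinduct)
  let ?A = "{\<lambda>x. \<phi> (- x) |\<phi>. \<phi> \<in> schwartz}"
  show "(\<lambda>x. \<phi> (- x)) \<in> ?A" using assms by blast
  fix \<eta> assume "\<eta> \<in> ?A"
  then obtain \<phi> where *: "\<eta> = (\<lambda>x. \<phi> (- x))" "\<phi> \<in> schwartz" by blast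
  show "rapid_decay \<eta>" using * rapid_decay_reflect schwartz_rapid_decay by blast
  have "has_grad \<eta> (\<lambda>j x. - pderivs [j] \<phi> (- x))"
    unfolding *(1) by (intro has_grad_reflect schwartz_has_grad *)
  moreover have "(\<lambda>x. - pderivs [j] \<phi> (- x)) \<in> ?A" for j
    using schwartz_cmult[OF schwartz_pderivs[OF *(2), of "[j]"], of "- 1"] by auto
  ultimately show "\<exists>\<eta>'. has_grad \<eta> \<eta>' \<and> (\<forall>j. \<eta>' j \<in> ?A)" by blast
qed

lemma schwartz_coord:
  assumes "\<psi> \<in> schwartz"
  shows "(\<lambda>x. x $ i *\<^sub>R \<psi> x) \<in> schwartz"
proof (rule schwartz_coinduct)
  \<comment> \<open>The functions x_i psi alone do not form an invariant set: differentiation in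
    direction \<open>i\<close> releases a summand psi. An additional arbitrary Schwartz summand
    repairs this; for the given function that summand is zero, obtained as 0 times psi.\<close>
  let ?A = "{\<lambda>x. \<phi> x + x $ i *\<^sub>R \<psi> x |\<phi> \<psi>. \<phi> \<in> schwartz \<and> \<psi> \<in> schwartz}"
  show "(\<lambda>x. x $ i *\<^sub>R \<psi> x) \<in> ?A"
    using assms schwartz_cmult[OF assms, of 0] by force
  fix \<eta> assume "\<eta> \<in> ?A"
  then obtain \<phi> \<psi> where *: "\<eta> = (\<lambda>x. \<phi> x + x $ i *\<^sub>R \<psi> x)" "\<phi> \<in> schwartz" "\<psi> \<in> schwartz" by blast
  show "rapid_decay \<eta>"
    unfolding *(1) by (intro rapid_decay_add rapid_decay_coord schwartz_rapid_decay *)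
  let ?\<phi>' = "\<lambda>j x. pderivs [j] \<phi> x + (if j = i then \<psi> x else 0)"
  have "has_grad \<eta> (\<lambda>j x. pderivs [j] \<phi> x + ((if j = i then \<psi> x else 0) + x $ i *\<^sub>R pderivs [j] \<psi> x))"
    unfolding *(1) by (intro has_grad_add has_grad_coord schwartz_has_grad *)
  then have "has_grad \<eta> (\<lambda>j x. ?\<phi>' j x + x $ i *\<^sub>R pderivs [j] \<psi> x)"
    by (simp add: add.assoc)
  moreover have "?\<phi>' j \<in> schwartz" for j
    using schwartz_add[OF schwartz_pderivs[OF *(2)] *(3), of "[j]"] schwartz_pderivs[OF *(2), of "[j]"]
    by (cases "j = i") auto
  then have "(\<lambda>x. ?\<phi>' j x + x $ i *\<^sub>R pderivs [j] \<psi> x) \<in> ?A" for j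
    using schwartz_pderivs[OF *(3), of "[j]"]
    by (intro CollectI exI[of _ "?\<phi>' j"] exI[of _ "pderivs [j] \<psi>"]) blast
  ultimately show "\<exists>\<eta>'. has_grad \<eta> \<eta>' \<and> (\<forall>j. \<eta>' j \<in> ?A)" by blast
qed

section \<open>Schwartz functions vanishing to infinite order at the origin\<close>

text \<open>Rapid decay at infinity and vanishing of infinite order at the origin in one bound. No
  derivative occurs in it, so any factor bounded by a power of the weight preserves it, even one
  that is singular at 0.\<close>

definition rapidly_flat :: "(real ^ 'd \<Rightarrow> complex) \<Rightarrow> bool" where
  "rapidly_flat \<psi> \<longleftrightarrow> \<psi> 0 = 0 \<and> (\<forall>k. \<exists>C. \<forall>x. x \<noteq> 0 \<longrightarrow> pole_weight (norm x) ^ k * norm (\<psi> x) \<le> C)"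

text \<open>Mirrors \<open>moderate\<close>, so that one induction can descend in the multiplier and
  in the function together.\<close>

primrec flat_upto :: "nat \<Rightarrow> (real ^ 'd \<Rightarrow> complex) \<Rightarrow> bool" where
  "flat_upto 0 \<psi> \<longleftrightarrow> rapidly_flat \<psi>"
| "flat_upto (Suc n) \<psi> \<longleftrightarrow> rapidly_flat \<psi> \<and> (\<exists>\<psi>'. has_grad \<psi> \<psi>' \<and> (\<forall>j. flat_upto n (\<psi>' j)))"

text \<open>The Fourier image of \<open>Z_space\<close>, by \<open>Z_space_iff\<close> and
  \<open>inv_fourier_Z_space\<close>.\<close>

definition flat_schwartz :: "(real ^ 'd \<Rightarrow> complex) set" where
  "flat_schwartz = {\<psi> \<in> schwartz. \<forall>is. pderivs is \<psi> 0 = 0}"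

lemma flat_schwartz_pderivs: "\<psi> \<in> flat_schwartz \<Longrightarrow> pderivs is \<psi> \<in> flat_schwartz"
  unfolding flat_schwartz_def mem_Collect_eq pderivs_append[symmetric]
  using schwartz_pderivs by blast

lemma flat_upto_imp_rapidly_flat: "flat_upto n \<psi> \<Longrightarrow> rapidly_flat \<psi>"
  by (cases n) auto

lemma flat_upto_SucI:
  "rapidly_flat \<psi> \<Longrightarrow> has_grad \<psi> \<psi>' \<Longrightarrow> (\<And>j. flat_upto n (\<psi>' j)) \<Longrightarrow> flat_upto (Suc n) \<psi>"
  by auto

lemma flat_upto_SucE:
  assumes "flat_upto (Suc n) \<psi>"
  obtains \<psi>' where "has_grad \<psi> \<psi>'" "\<And>j. flat_upto n (\<psi>' j)"
  using assms by auto

lemma flat_upto_Suc_imp: "flat_upto (Suc n) \<psi> \<Longrightarrow> flat_upto n \<psi>"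
proof (induction n arbitrary: \<psi>)
  case 0
  then show ?case by simp
next
  case (Suc n)
  obtain \<psi>' where *: "has_grad \<psi> \<psi>'" "\<And>j. flat_upto (Suc n) (\<psi>' j)"
    using flat_upto_SucE[OF Suc.prems] by blast
  show ?case
    by (rule flat_upto_SucI[OF flat_upto_imp_rapidly_flat[OF Suc.prems] *(1) Suc.IH[OF *(2)]])
qed

lemma rapidly_flat_rapid_decay:
  fixes \<psi> :: "real ^ 'd \<Rightarrow> complex"
  assumes "rapidly_flat \<psi>"
  shows "rapid_decay \<psi>"
  unfolding rapid_decay_def
proof
  fix k
  obtain C where C: "\<And>x. x \<noteq> 0 \<Longrightarrow> pole_weight (norm x) ^ k * norm (\<psi> x) \<le> C" and 0: "\<psi> 0 = 0"
    using assms unfolding rapidly_flat_def by blast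
  have "(1 + norm x) ^ k * norm (\<psi> x) \<le> 2 ^ k * \<bar>C\<bar>" for x
  proof (cases "x = 0")
    case True
    then show ?thesis using 0 by simp
  next
    case False
    then have "1 + norm x \<le> 2 * pole_weight (norm x)"
      using pole_weight_ge_1[of "norm x"] pole_weight_ge(1)[of "norm x"] by simp
    then have "(1 + norm x) ^ k * norm (\<psi> x) \<le> (2 * pole_weight (norm x)) ^ k * norm (\<psi> x)"
      by (intro mult_right_mono power_mono) auto
    also have "\<dots> = 2 ^ k * (pole_weight (norm x) ^ k * norm (\<psi> x))" by (simp add: power_mult_distrib)
    also have "\<dots> \<le> 2 ^ k * \<bar>C\<bar>" using C[OF False] by (intro mult_left_mono) auto
    finally show ?thesis .
  qed
  then show "\<exists>C. \<forall>x. (1 + norm x) ^ k * norm (\<psi> x) \<le> C" by blast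
qed

text \<open>The gradients provided by \<open>flat_upto\<close> could differ from level to level.
  Uniqueness identifies all of them with \<open>pderivs\<close>, so the functions flat to every
  order form a set invariant under gradients and \<open>schwartz_coinduct\<close> applies. That all
  derivatives vanish at 0 is contained in their rapid flatness.\<close>

lemma flat_schwartzI:
  assumes "\<And>n. flat_upto n \<psi>"
  shows "\<psi> \<in> flat_schwartz"
proof -
  let ?A = "{\<psi>. \<forall>n. flat_upto n \<psi>}"
  have \<psi>: "\<psi> \<in> ?A" using assms by blast
  have step: "\<exists>\<psi>'. has_grad \<psi> \<psi>' \<and> (\<forall>j. \<psi>' j \<in> ?A)" if "\<psi> \<in> ?A" for \<psi>
  proof -
    have "has_grad \<psi> (\<lambda>j. pderivs [j] \<psi>) \<and> flat_upto n (pderivs [j] \<psi>)" for n j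
    proof -
      have "flat_upto (Suc n) \<psi>" using that by blast
      from flat_upto_SucE[OF this]
      obtain \<psi>' where \<psi>': "has_grad \<psi> \<psi>'" "\<And>j. flat_upto n (\<psi>' j)"
        by blast
      have "(\<lambda>j. pderivs [j] \<psi>) = \<psi>'" using has_grad_unique[OF \<psi>'(1)] by blast
      then show ?thesis using \<psi>' by metis
    qed
    then show ?thesis by blast
  qed
  have flat: "rapidly_flat \<psi>" if "\<psi> \<in> ?A" for \<psi> using that flat_upto_imp_rapidly_flat by blast
  have "\<psi> \<in> schwartz"
    using schwartz_coinduct[OF \<psi> _ step] flat rapidly_flat_rapid_decay by blast
  moreover have "rapidly_flat (pderivs is \<psi>)" for "is"
    using flat pderivs_mem[OF \<psi> step] by blast
  ultimately show ?thesis unfolding flat_schwartz_def rapidly_flat_def by blast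
qed

lemma norm_grad_le:
  fixes h :: "real ^ 'd" and c :: "'d \<Rightarrow> complex"
  shows "norm (\<Sum>j\<in>UNIV. h $ j *\<^sub>R c j) \<le> (\<Sum>j\<in>UNIV. norm (c j)) * norm h"
proof -
  have "norm (\<Sum>j\<in>UNIV. h $ j *\<^sub>R c j) \<le> (\<Sum>j\<in>UNIV. norm (h $ j *\<^sub>R c j))" by (rule norm_sum)
  also have "\<dots> \<le> (\<Sum>j\<in>UNIV. norm (c j) * norm h)"
  proof (rule sum_mono)
    fix j
    show "norm (h $ j *\<^sub>R c j) \<le> norm (c j) * norm h"
      using mult_right_mono[OF component_le_norm_cart[of h j], of "norm (c j)"]
      by (simp add: mult.commute)
  qed
  finally show ?thesis by (simp add: sum_distrib_right)
qed

text \<open>Mean value inequality on the ball of radius |x|: as psi(0) = 0, bounds of order l on the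
  first derivatives become a bound of order l + 1 on psi. The derivatives are flat again, so the
  induction runs over the whole class.\<close>

lemma flat_schwartz_power_bound:
  fixes \<psi> :: "real ^ 'd \<Rightarrow> complex"
  assumes "\<psi> \<in> flat_schwartz"
  shows "\<exists>C. \<forall>x. norm (\<psi> x) \<le> C * norm x ^ l"
  using assms
proof (induction l arbitrary: \<psi>)
  case 0
  then have "rapid_decay \<psi>" by (simp add: flat_schwartz_def schwartz_rapid_decay)
  then obtain C where "\<And>x. (1 + norm x) ^ 0 * norm (\<psi> x) \<le> C" using rapid_decayD by metis
  then show ?case by auto
next
  case (Suc l)
  have "\<exists>C. \<forall>x. norm (pderivs [j] \<psi> x) \<le> C * norm x ^ l" for j
    using Suc.IH[OF flat_schwartz_pderivs[OF Suc.prems]] .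
  then obtain C where C: "\<And>j x. norm (pderivs [j] \<psi> x) \<le> C j * norm x ^ l" by metis
  have C0: "0 \<le> C j" for j
  proof -
    have "norm (axis j (1::real)) = 1" by simp
    then show ?thesis using order_trans[OF norm_ge_zero C[of j "axis j 1"]] by simp
  qed
  have \<psi>: "\<psi> \<in> schwartz" "\<psi> 0 = 0"
    using Suc.prems pderivs.simps(1)[of \<psi>] unfolding flat_schwartz_def by (auto dest: spec[of _ "[]"])
  have "norm (\<psi> x) \<le> (\<Sum>j\<in>UNIV. C j) * norm x ^ Suc l" for x
  proof -
    have "norm (\<psi> x - \<psi> 0) \<le> (\<Sum>j\<in>UNIV. C j * norm x ^ l) * norm (x - 0)"
    proof (rule differentiable_bound)
      fix y :: "real ^ 'd" assume "y \<in> cball 0 (norm x)"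
      then have y: "norm y \<le> norm x" by simp
      show "(\<psi> has_derivative (\<lambda>h. \<Sum>j\<in>UNIV. h $ j *\<^sub>R pderivs [j] \<psi> y)) (at y within cball 0 (norm x))"
        using has_gradD[OF schwartz_has_grad[OF \<psi>(1)]] by (rule has_derivative_at_withinI)
      show "onorm (\<lambda>h. \<Sum>j\<in>UNIV. h $ j *\<^sub>R pderivs [j] \<psi> y) \<le> (\<Sum>j\<in>UNIV. C j * norm x ^ l)"
      proof (rule onorm_le)
        fix h :: "real ^ 'd"
        have "norm (pderivs [j] \<psi> y) \<le> C j * norm x ^ l" for j
          using C[of j y] mult_left_mono[OF power_mono[OF y, of l] C0[of j]] by simp
        then have "(\<Sum>j\<in>UNIV. norm (pderivs [j] \<psi> y)) * norm h \<le> (\<Sum>j\<in>UNIV. C j * norm x ^ l) * norm h"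
          by (intro mult_right_mono sum_mono) auto
        then show "norm (\<Sum>j\<in>UNIV. h $ j *\<^sub>R pderivs [j] \<psi> y) \<le> (\<Sum>j\<in>UNIV. C j * norm x ^ l) * norm h"
          using norm_grad_le[of h "\<lambda>j. pderivs [j] \<psi> y"] by linarith
      qed
    qed auto
    then show ?thesis using \<psi>(2) by (simp add: sum_distrib_right ac_simps)
  qed
  then show ?case by blast
qed

text \<open>In the unit ball the weight is at most 2/|x|, which the bound of psi by a multiple of
  |x|^k compensates; outside it the weight is at most 1 + |x|, and rapid decay takes over.\<close>

lemma flat_schwartz_rapidly_flat:
  fixes \<psi> :: "real ^ 'd \<Rightarrow> complex"
  assumes "\<psi> \<in> flat_schwartz"
  shows "rapidly_flat \<psi>"
  unfolding rapidly_flat_def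
proof (intro conjI allI)
  show "\<psi> 0 = 0"
    using assms pderivs.simps(1)[of \<psi>] unfolding flat_schwartz_def by (auto dest: spec[of _ "[]"])
  fix k
  obtain C where C: "\<And>x. norm (\<psi> x) \<le> C * norm x ^ k"
    using flat_schwartz_power_bound[OF assms] by blast
  have "rapid_decay \<psi>" using assms by (simp add: flat_schwartz_def schwartz_rapid_decay)
  then obtain D where D: "\<And>x. (1 + norm x) ^ k * norm (\<psi> x) \<le> D" using rapid_decayD by metis
  have "pole_weight (norm x) ^ k * norm (\<psi> x) \<le> max (2 ^ k * C) D" if x: "x \<noteq> 0" for x
  proof (cases "norm x \<le> 1")
    case True
    have "norm x * norm x \<le> 1" using True by (simp add: mult_le_one)
    then have "pole_weight (norm x) \<le> 2 * inverse (norm x)"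
      using x unfolding pole_weight_def by (simp add: field_simps)
    then have "pole_weight (norm x) ^ k * norm (\<psi> x) \<le> (2 * inverse (norm x)) ^ k * (C * norm x ^ k)"
      using pole_weight_ge_1[of "norm x"] x C[of x] by (intro mult_mono power_mono) auto
    also have "\<dots> = 2 ^ k * C" using x by (simp add: power_mult_distrib field_simps)
    finally show ?thesis by simp
  next
    case False
    then have "pole_weight (norm x) \<le> 1 + norm x" unfolding pole_weight_def by (simp add: inverse_le_1_iff)
    then have "pole_weight (norm x) ^ k * norm (\<psi> x) \<le> (1 + norm x) ^ k * norm (\<psi> x)"
      using pole_weight_ge_1[of "norm x"] x by (intro mult_right_mono power_mono) auto
    then show ?thesis using D[of x] by simp
  qed
  then show "\<exists>C. \<forall>x. x \<noteq> 0 \<longrightarrow> pole_weight (norm x) ^ k * norm (\<psi> x) \<le> C" by blast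
qed

lemma flat_schwartz_flat_upto: "\<psi> \<in> flat_schwartz \<Longrightarrow> flat_upto n \<psi>"
proof (induction n arbitrary: \<psi>)
  case 0
  then show ?case by (simp add: flat_schwartz_rapidly_flat)
next
  case (Suc n)
  show ?case
  proof (rule flat_upto_SucI)
    show "rapidly_flat \<psi>" using Suc.prems by (rule flat_schwartz_rapidly_flat)
    show "has_grad \<psi> (\<lambda>j. pderivs [j] \<psi>)"
      using Suc.prems by (intro schwartz_has_grad) (simp add: flat_schwartz_def)
    show "flat_upto n (pderivs [j] \<psi>)" for j
      using Suc.prems by (intro Suc.IH flat_schwartz_pderivs)
  qed
qed

section \<open>Operations on flat functions and radial multipliers\<close>

lemma rapidly_flat_add:
  assumes "rapidly_flat \<phi>" "rapidly_flat \<psi>"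
  shows "rapidly_flat (\<lambda>x. \<phi> x + \<psi> x)"
  unfolding rapidly_flat_def
proof (intro conjI allI)
  show "\<phi> 0 + \<psi> 0 = 0" using assms by (simp add: rapidly_flat_def)
  fix k
  obtain C D where C: "\<And>x. x \<noteq> 0 \<Longrightarrow> pole_weight (norm x) ^ k * norm (\<phi> x) \<le> C"
    and D: "\<And>x. x \<noteq> 0 \<Longrightarrow> pole_weight (norm x) ^ k * norm (\<psi> x) \<le> D"
    using assms unfolding rapidly_flat_def by metis
  have "pole_weight (norm x) ^ k * norm (\<phi> x + \<psi> x) \<le> C + D" if x: "x \<noteq> 0" for x
  proof -
    have "pole_weight (norm x) ^ k * norm (\<phi> x + \<psi> x) \<le> pole_weight (norm x) ^ k * (norm (\<phi> x) + norm (\<psi> x))"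
      using pole_weight_ge_1[of "norm x"] x by (intro mult_left_mono norm_triangle_ineq) auto
    then show ?thesis using C[OF x] D[OF x] by (simp add: distrib_left)
  qed
  then show "\<exists>C. \<forall>x. x \<noteq> 0 \<longrightarrow> pole_weight (norm x) ^ k * norm (\<phi> x + \<psi> x) \<le> C" by blast
qed

text \<open>The l powers of the weight that \<open>m\<close> costs are taken from the bound of order
  k + l on psi. The value \<open>m 0\<close> is arbitrary because psi(0) = 0.\<close>

lemma rapidly_flat_mult:
  fixes m :: "real ^ 'd \<Rightarrow> complex"
  assumes "rapidly_flat \<psi>" and m: "\<And>x. x \<noteq> 0 \<Longrightarrow> norm (m x) \<le> C * pole_weight (norm x) ^ l"
  shows "rapidly_flat (\<lambda>x. m x * \<psi> x)"
  unfolding rapidly_flat_def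
proof (intro conjI allI)
  show "m 0 * \<psi> 0 = 0" using assms by (simp add: rapidly_flat_def)
  fix k
  obtain D where D: "\<And>x. x \<noteq> 0 \<Longrightarrow> pole_weight (norm x) ^ (k + l) * norm (\<psi> x) \<le> D"
    using assms unfolding rapidly_flat_def by metis
  \<comment> \<open>The sign of \<open>C\<close> is read off from the bound at a unit
    vector.\<close>
  have C0: "0 \<le> C"
  proof -
    obtain x :: "real ^ 'd" where x: "norm x = 1" using vector_choose_size[of 1] by auto
    then have "x \<noteq> 0" by auto
    then have "norm (m x) \<le> C * pole_weight 1 ^ l" using m[of x] x by simp
    then have "0 \<le> C * pole_weight 1 ^ l" using norm_ge_zero[of "m x"] by linarith
    moreover have "0 < pole_weight 1 ^ l" by (simp add: pole_weight_def)
    ultimately show ?thesis by (meson mult_neg_pos not_le)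
  qed
  have "pole_weight (norm x) ^ k * norm (m x * \<psi> x) \<le> C * D" if x: "x \<noteq> 0" for x
  proof -
    have "pole_weight (norm x) ^ k * norm (m x * \<psi> x) \<le> pole_weight (norm x) ^ k * ((C * pole_weight (norm x) ^ l) * norm (\<psi> x))"
      using mult_right_mono[OF m[OF x] norm_ge_zero[of "\<psi> x"]] pole_weight_ge_1[of "norm x"] x
      unfolding norm_mult by (intro mult_left_mono) auto
    also have "\<dots> = C * (pole_weight (norm x) ^ (k + l) * norm (\<psi> x))" by (simp add: power_add)
    also have "\<dots> \<le> C * D" using D[OF x] C0 by (intro mult_left_mono)
    finally show ?thesis .
  qed
  then show "\<exists>C. \<forall>x. x \<noteq> 0 \<longrightarrow> pole_weight (norm x) ^ k * norm (m x * \<psi> x) \<le> C" by blast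
qed

lemma flat_upto_add: "flat_upto n \<phi> \<Longrightarrow> flat_upto n \<psi> \<Longrightarrow> flat_upto n (\<lambda>x. \<phi> x + \<psi> x)"
proof (induction n arbitrary: \<phi> \<psi>)
  case 0
  then show ?case by (simp add: rapidly_flat_add)
next
  case (Suc n)
  obtain \<phi>' \<psi>' where *: "has_grad \<phi> \<phi>'" "\<And>j. flat_upto n (\<phi>' j)"
    "has_grad \<psi> \<psi>'" "\<And>j. flat_upto n (\<psi>' j)"
    using Suc.prems by (metis flat_upto_SucE)
  show ?case
    by (rule flat_upto_SucI[OF rapidly_flat_add has_grad_add[OF *(1,3)] Suc.IH[OF *(2,4)]])
      (use Suc.prems flat_upto_imp_rapidly_flat in blast)+
qed

lemma rapidly_flat_cmult: "rapidly_flat \<psi> \<Longrightarrow> rapidly_flat (\<lambda>x. c * \<psi> x)"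
  using rapidly_flat_mult[of \<psi> "\<lambda>x. c" "norm c" 0] by simp

lemma flat_upto_cmult: "flat_upto n \<psi> \<Longrightarrow> flat_upto n (\<lambda>x. c * \<psi> x)"
proof (induction n arbitrary: \<psi>)
  case 0
  then show ?case by (simp add: rapidly_flat_cmult)
next
  case (Suc n)
  obtain \<psi>' where *: "has_grad \<psi> \<psi>'" "\<And>j. flat_upto n (\<psi>' j)"
    using Suc.prems by (metis flat_upto_SucE)
  show ?case
    by (rule flat_upto_SucI[OF rapidly_flat_cmult has_grad_cmult[OF *(1)] Suc.IH[OF *(2)]])
      (rule flat_upto_imp_rapidly_flat[OF Suc.prems])
qed

lemma rapidly_flat_coord:
  assumes "rapidly_flat \<psi>"
  shows "rapidly_flat (\<lambda>x. x $ i *\<^sub>R \<psi> x)"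
  unfolding scaleR_conv_of_real
proof (rule rapidly_flat_mult[OF assms])
  show "norm (complex_of_real (x $ i)) \<le> 1 * pole_weight (norm x) ^ 1" if "x \<noteq> 0" for x
    using component_le_norm_cart[of x i] pole_weight_ge(1)[of "norm x"] that by simp
qed

lemma flat_upto_coord: "flat_upto n \<psi> \<Longrightarrow> flat_upto n (\<lambda>x. x $ i *\<^sub>R \<psi> x)"
proof (induction n arbitrary: \<psi>)
  case 0
  then show ?case by (simp add: rapidly_flat_coord)
next
  case (Suc n)
  obtain \<psi>' where *: "has_grad \<psi> \<psi>'" "\<And>j. flat_upto n (\<psi>' j)"
    using Suc.prems by (metis flat_upto_SucE)
  have "flat_upto n (\<lambda>x. (if j = i then \<psi> x else 0) + x $ i *\<^sub>R \<psi>' j x)" for j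
    using flat_upto_add[OF flat_upto_Suc_imp[OF Suc.prems] Suc.IH[OF *(2)]] Suc.IH[OF *(2)]
    by (cases "j = i") auto
  then show ?case
    by (intro flat_upto_SucI[OF rapidly_flat_coord has_grad_coord[OF *(1)]]
        flat_upto_imp_rapidly_flat[OF Suc.prems])
qed

text \<open>At the origin the radial factor may be singular, but the product still vanishes
  to second order there.\<close>

lemma rapidly_flat_has_derivative_0:
  fixes \<psi> :: "real ^ 'd \<Rightarrow> complex"
  assumes "rapidly_flat \<psi>"
  shows "(\<psi> has_derivative (\<lambda>h. 0)) (at 0)"
proof -
  obtain C where C: "\<And>x. x \<noteq> 0 \<Longrightarrow> pole_weight (norm x) ^ 2 * norm (\<psi> x) \<le> C" and 0: "\<psi> 0 = 0"
    using assms unfolding rapidly_flat_def by metis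
  show ?thesis
  proof (rule has_derivative_of_quadratic_remainder[where d = 1])
    fix h :: "real ^ 'd"
    show "norm (\<psi> (0 + h) - \<psi> 0 - 0) \<le> (norm h)\<^sup>2 * C"
    proof (cases "h = 0")
      case False
      have "(inverse (norm h))\<^sup>2 * norm (\<psi> h) \<le> pole_weight (norm h) ^ 2 * norm (\<psi> h)"
        using pole_weight_ge(2)[of "norm h"] False by (intro mult_right_mono power_mono) auto
      then have "(inverse (norm h))\<^sup>2 * norm (\<psi> h) \<le> C" using C[OF False] by linarith
      then show ?thesis using 0 False by (simp add: field_simps)
    qed (use 0 in simp)
  qed auto
qed

lemma rapidly_flat_radial_mult:
  assumes "moderate_growth g" "rapidly_flat \<psi>"
  shows "rapidly_flat (\<lambda>x. complex_of_real (g ((norm x)\<^sup>2)) * \<psi> x)"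
proof -
  obtain C k where C: "0 \<le> C" "\<And>s. s > 0 \<Longrightarrow> \<bar>g s\<bar> \<le> C * pole_weight s ^ k"
    using assms(1) unfolding moderate_growth_def by blast
  show ?thesis
  proof (rule rapidly_flat_mult[OF assms(2), of _ C "2 * k"])
    fix x :: "real ^ 'a" assume x: "x \<noteq> 0"
    \<comment> \<open>(r + 1/r)^2 = r^2 + 1/r^2 + 2, which is why the exponent doubles to
      \<open>2 * k\<close>.\<close>
    have "pole_weight ((norm x)\<^sup>2) \<le> (pole_weight (norm x))\<^sup>2"
      using x unfolding pole_weight_def by (simp add: power2_sum power_inverse)
    then have "C * pole_weight ((norm x)\<^sup>2) ^ k \<le> C * ((pole_weight (norm x))\<^sup>2) ^ k"
      using x C(1) pole_weight_ge_1[of "(norm x)\<^sup>2"] by (intro mult_left_mono power_mono) auto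
    then show "norm (complex_of_real (g ((norm x)\<^sup>2))) \<le> C * pole_weight (norm x) ^ (2 * k)"
      using C(2)[of "(norm x)\<^sup>2"] x by (simp add: power_mult)
  qed
qed

text \<open>The j-th partial derivative is 2 x_j g'(|x|^2) psi + g(|x|^2) psi_j. These are two
  products of the same kind, each with multiplier and function controlled to order n, so the
  induction closes.\<close>

lemma flat_upto_radial_mult:
  fixes \<psi> :: "real ^ 'd \<Rightarrow> complex"
  shows "moderate n g \<Longrightarrow> flat_upto n \<psi> \<Longrightarrow>
    flat_upto n (\<lambda>x. complex_of_real (g ((norm x)\<^sup>2)) * \<psi> x)"
proof (induction n arbitrary: g \<psi>)
  case 0
  then show ?case by (simp add: rapidly_flat_radial_mult)
next
  case (Suc n)
  obtain \<psi>' where \<psi>': "has_grad \<psi> \<psi>'" "\<And>j. flat_upto n (\<psi>' j)"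
    using Suc.prems(2) by (metis flat_upto_SucE)
  obtain g' where g': "\<And>s. s > 0 \<Longrightarrow> (g has_real_derivative g' s) (at s)" "moderate n g'"
    using Suc.prems(1) by auto
  let ?\<eta> = "\<lambda>x. complex_of_real (g ((norm x)\<^sup>2)) * \<psi> x"
  let ?\<eta>' = "\<lambda>j x. complex_of_real (g' ((norm x)\<^sup>2)) * (2 * (x $ j *\<^sub>R \<psi> x))
    + complex_of_real (g ((norm x)\<^sup>2)) * \<psi>' j x"
  have flat: "rapidly_flat ?\<eta>"
    by (rule rapidly_flat_radial_mult[OF moderate_imp_growth[OF Suc.prems(1)]
          flat_upto_imp_rapidly_flat[OF Suc.prems(2)]])
  have grad: "has_grad ?\<eta> ?\<eta>'"
    unfolding has_grad_def
  proof
    fix x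
    show "(?\<eta> has_derivative (\<lambda>h. \<Sum>j\<in>UNIV. h $ j *\<^sub>R ?\<eta>' j x)) (at x)"
    proof (cases "x = 0")
      case True
      \<comment> \<open>Neither \<open>g\<close> nor \<open>g'\<close> is controlled at 0, but psi
        and its gradient vanish there; the formula thus gives 0, in agreement with the second-order
        vanishing of the product.\<close>
      have "\<psi> 0 = 0" "\<psi>' j 0 = 0" for j
        using flat_upto_imp_rapidly_flat[OF \<psi>'(2)] flat_upto_imp_rapidly_flat[OF Suc.prems(2)]
        by (auto simp: rapidly_flat_def)
      then show ?thesis using rapidly_flat_has_derivative_0[OF flat] True by simp
    next
      case False
      have "((\<lambda>y. (norm y)\<^sup>2) has_derivative (\<lambda>h. 2 * (x \<bullet> h))) (at x)"
        unfolding power2_norm_eq_inner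
        using has_derivative_inner[OF has_derivative_ident has_derivative_ident, of x UNIV]
        by (simp add: inner_commute)
      from has_derivative_compose[OF this, of g "times (g' ((norm x)\<^sup>2))"]
      have "((\<lambda>y. g ((norm y)\<^sup>2)) has_derivative (\<lambda>h. g' ((norm x)\<^sup>2) * (2 * (x \<bullet> h)))) (at x)"
        using g'(1)[of "(norm x)\<^sup>2"] False by (simp add: has_field_derivative_def)
      from has_derivative_mult[OF has_derivative_of_real[OF this] has_gradD[OF \<psi>'(1)]]
      have "(?\<eta> has_derivative (\<lambda>h. complex_of_real (g ((norm x)\<^sup>2)) * (\<Sum>j\<in>UNIV. h $ j *\<^sub>R \<psi>' j x)
          + complex_of_real (g' ((norm x)\<^sup>2) * (2 * (x \<bullet> h))) * \<psi> x)) (at x)" .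
      then show ?thesis
      proof (rule has_derivative_eq_rhs)
        show "(\<lambda>h. complex_of_real (g ((norm x)\<^sup>2)) * (\<Sum>j\<in>UNIV. h $ j *\<^sub>R \<psi>' j x)
          + complex_of_real (g' ((norm x)\<^sup>2) * (2 * (x \<bullet> h))) * \<psi> x)
          = (\<lambda>h. \<Sum>j\<in>UNIV. h $ j *\<^sub>R ?\<eta>' j x)"
        proof (rule ext)
          fix h :: "real ^ 'd"
          have "(\<Sum>j\<in>UNIV. h $ j *\<^sub>R (complex_of_real (g' ((norm x)\<^sup>2)) * (2 * (x $ j *\<^sub>R \<psi> x))))
              = complex_of_real (g' ((norm x)\<^sup>2) * (2 * (x \<bullet> h))) * \<psi> x"
          proof -
            have "(\<Sum>j\<in>UNIV. h $ j *\<^sub>R (complex_of_real (g' ((norm x)\<^sup>2)) * (2 * (x $ j *\<^sub>R \<psi> x))))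
                = (\<Sum>j\<in>UNIV. complex_of_real (x $ j * h $ j)) * (2 * complex_of_real (g' ((norm x)\<^sup>2)) * \<psi> x)"
              unfolding sum_distrib_right by (rule sum.cong) (simp_all add: scaleR_conv_of_real)
            then show ?thesis by (simp add: inner_vec_def)
          qed
          moreover have "(\<Sum>j\<in>UNIV. h $ j *\<^sub>R (complex_of_real (g ((norm x)\<^sup>2)) * \<psi>' j x))
              = complex_of_real (g ((norm x)\<^sup>2)) * (\<Sum>j\<in>UNIV. h $ j *\<^sub>R \<psi>' j x)"
            by (simp add: sum_distrib_left)
          ultimately show "complex_of_real (g ((norm x)\<^sup>2)) * (\<Sum>j\<in>UNIV. h $ j *\<^sub>R \<psi>' j x)
              + complex_of_real (g' ((norm x)\<^sup>2) * (2 * (x \<bullet> h))) * \<psi> x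
              = (\<Sum>j\<in>UNIV. h $ j *\<^sub>R ?\<eta>' j x)"
            by (simp only: scaleR_add_right sum.distrib add.commute)
        qed
      qed
    qed
  qed
  have "flat_upto n (?\<eta>' j)" for j
    by (rule flat_upto_add[OF
          Suc.IH[OF g'(2) flat_upto_cmult[OF flat_upto_coord[OF flat_upto_Suc_imp[OF Suc.prems(2)]]]]
          Suc.IH[OF moderate_Suc_imp[OF Suc.prems(1)] \<psi>'(2)]])
  then show ?case by (rule flat_upto_SucI[OF flat grad])
qed

lemma flat_schwartz_radial_mult:
  assumes "\<And>n. moderate n g" "\<psi> \<in> flat_schwartz"
  shows "(\<lambda>x. complex_of_real (g ((norm x)\<^sup>2)) * \<psi> x) \<in> flat_schwartz"
  by (rule flat_schwartzI[OF flat_upto_radial_mult[OF assms(1) flat_schwartz_flat_upto[OF assms(2)]]])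


section \<open>Integration on Euclidean space\<close>

lemma
  fixes F :: "'a::euclidean_space \<Rightarrow> real \<Rightarrow> 'b::{real_normed_field, banach, second_countable_topology}"
  assumes F: "\<And>b. b \<in> Basis \<Longrightarrow> integrable lborel (F b)"
  shows integrable_prod_Basis: "integrable lborel (\<lambda>x. \<Prod>b\<in>Basis. F b (x \<bullet> b))"
    and integral_prod_Basis:
      "(\<integral>x. (\<Prod>b\<in>Basis. F b (x \<bullet> b)) \<partial>lborel) = (\<Prod>b\<in>Basis. \<integral>t. F b t \<partial>lborel)"
proof -
  interpret product_sigma_finite "\<lambda>_::'a. lborel :: real measure" ..
  have [measurable]: "b \<in> Basis \<Longrightarrow> F b \<in> borel_measurable borel" for b
    using borel_measurable_integrable[OF F] by simp
  let ?P = "\<Pi>\<^sub>M b\<in>(Basis::'a set). (lborel :: real measure)"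
  let ?T = "\<lambda>f. \<Sum>b\<in>(Basis::'a set). f b *\<^sub>R b"
  have T: "?T \<in> ?P \<rightarrow>\<^sub>M borel" by measurable
  have m: "(\<lambda>x. \<Prod>b\<in>Basis. F b (x \<bullet> b)) \<in> borel_measurable borel" by measurable
  have eq: "(\<Prod>b\<in>Basis. F b (?T f \<bullet> b)) = (\<Prod>b\<in>Basis. F b (f b))" for f
    by (rule prod.cong) auto
  show "integrable lborel (\<lambda>x. \<Prod>b\<in>Basis. F b (x \<bullet> b))"
    unfolding lborel_eq[where 'a='a] integrable_distr_eq[OF T m] eq
    by (rule product_integrable_prod) (auto intro: F)
  show "(\<integral>x. (\<Prod>b\<in>Basis. F b (x \<bullet> b)) \<partial>lborel) = (\<Prod>b\<in>Basis. \<integral>t. F b t \<partial>lborel)"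
    unfolding lborel_eq[where 'a='a] integral_distr[OF T m] eq
    by (rule product_integral_prod) (auto intro: F)
qed

text \<open>The exponent lets the inequality 1 + x_b^2 \<le> (1 + |x|)^2 be multiplied over all
  coordinates. The weight is thus dominated by the product of the one-dimensional functions 1/(1 +
  t^2), which is integrable.\<close>

definition decay_weight :: "'a::euclidean_space \<Rightarrow> real" where
  "decay_weight x = inverse ((1 + norm x) ^ (2 * DIM('a)))"

lemma decay_weight_pos: "0 < decay_weight x"
  by (simp add: decay_weight_def add_pos_nonneg)

lemma integrable_decay_weight: "integrable lborel (decay_weight :: 'a::euclidean_space \<Rightarrow> real)"
proof (rule Bochner_Integration.integrable_bound)
  have "integrable lborel (\<lambda>t::real. inverse (1 + t\<^sup>2))"
    using integrable_inverse_1_plus_square by (simp add: set_integrable_def)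
  then show "integrable lborel (\<lambda>x::'a. \<Prod>b\<in>Basis. inverse (1 + (x \<bullet> b)\<^sup>2))"
    by (rule integrable_prod_Basis)
  have "norm (decay_weight x) \<le> norm (\<Prod>b\<in>Basis. inverse (1 + (x \<bullet> b)\<^sup>2))" for x :: 'a
  proof -
    have "1 + (x \<bullet> b)\<^sup>2 \<le> (1 + norm x)\<^sup>2" if "b \<in> Basis" for b
    proof -
      have "(x \<bullet> b)\<^sup>2 \<le> (norm x)\<^sup>2"
        using Basis_le_norm[OF that, of x] by (metis abs_ge_zero power2_abs power_mono)
      moreover have "(1 + norm x)\<^sup>2 = 1 + (norm x)\<^sup>2 + 2 * norm x" by (simp add: power2_sum)
      ultimately show ?thesis using norm_ge_zero[of x] by linarith
    qed
    then have "(\<Prod>b\<in>(Basis::'a set). 1 + (x \<bullet> b)\<^sup>2) \<le> (\<Prod>b\<in>(Basis::'a set). (1 + norm x)\<^sup>2)"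
      by (intro prod_mono) (auto intro: add_nonneg_nonneg)
    also have "\<dots> = (1 + norm x) ^ (2 * DIM('a))" by (simp add: power_mult)
    finally have "inverse ((1 + norm x) ^ (2 * DIM('a))) \<le> inverse (\<Prod>b\<in>(Basis::'a set). 1 + (x \<bullet> b)\<^sup>2)"
      by (intro le_imp_inverse_le prod_pos) (auto intro: add_pos_nonneg)
    then show ?thesis
      by (simp add: decay_weight_def prod_inversef[symmetric] abs_prod flip: prod_inversef)
  qed
  then show "AE x in lborel. norm (decay_weight x) \<le> norm (\<Prod>b\<in>Basis. inverse (1 + ((x::'a) \<bullet> b)\<^sup>2))"
    by (intro AE_I2)
  show "(decay_weight :: 'a \<Rightarrow> real) \<in> borel_measurable lborel"
    unfolding decay_weight_def[abs_def] by measurable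
qed

lemma lborel_integral_affine:
  fixes f :: "'a::euclidean_space \<Rightarrow> 'b::{banach, second_countable_topology}"
  assumes "f \<in> borel_measurable borel" "c \<noteq> 0"
  shows "(\<integral>x. f x \<partial>lborel) = \<bar>c\<bar> ^ DIM('a) *\<^sub>R (\<integral>x. f (t + c *\<^sub>R x) \<partial>lborel)"
proof -
  have "(\<integral>x. f x \<partial>lborel)
      = (\<integral>x. f x \<partial>density (distr lborel borel (\<lambda>x. t + c *\<^sub>R x)) (\<lambda>_. ennreal (\<bar>c\<bar> ^ DIM('a))))"
    using lborel_affine[OF assms(2), of t] by (simp add: ennreal_power)
  also have "\<dots> = (\<integral>x. \<bar>c\<bar> ^ DIM('a) *\<^sub>R f x \<partial>distr lborel borel (\<lambda>x. t + c *\<^sub>R x))"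
    using assms by (intro integral_density) auto
  also have "\<dots> = (\<integral>x. \<bar>c\<bar> ^ DIM('a) *\<^sub>R f (t + c *\<^sub>R x) \<partial>lborel)"
    using assms by (intro integral_distr) auto
  finally show ?thesis by simp
qed

lemma lborel_integral_translate:
  fixes f :: "'a::euclidean_space \<Rightarrow> 'b::{banach, second_countable_topology}"
  assumes "f \<in> borel_measurable borel"
  shows "(\<integral>x. f (x + t) \<partial>lborel) = (\<integral>x. f x \<partial>lborel)"
  using lborel_integral_affine[OF assms, of 1 t] by (simp add: add.commute)

lemma lborel_integral_reflect:
  fixes f :: "'a::euclidean_space \<Rightarrow> 'b::{banach, second_countable_topology}"
  assumes "f \<in> borel_measurable borel"
  shows "(\<integral>x. f (- x) \<partial>lborel) = (\<integral>x. f x \<partial>lborel)"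
  using lborel_integral_affine[OF assms, of "- 1" 0] by simp

section \<open>The Gaussian and its Fourier transform\<close>

lemma norm_exp_minus_i [simp]: "norm (exp (- (\<i> * complex_of_real r))) = 1"
  by (simp add: norm_exp_eq_Re)

text \<open>The factor 1/2 in the exponent makes it its own Fourier transform up to a
  constant.\<close>

definition gaussian :: "'a::euclidean_space \<Rightarrow> real" where
  "gaussian x = exp (- (norm x)\<^sup>2 / 2)"

lemma gaussian_measurable [measurable]: "gaussian \<in> borel_measurable borel"
  unfolding gaussian_def[abs_def] by measurable

lemma gaussian_bounds: "0 < gaussian x" "gaussian x \<le> 1"
  by (auto simp: gaussian_def)

lemma gaussian_eq_prod: "gaussian x = (\<Prod>b\<in>Basis. exp (- (x \<bullet> b)\<^sup>2 / 2))"
proof -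
  have "(norm x)\<^sup>2 = (\<Sum>b\<in>Basis. (x \<bullet> b)\<^sup>2)"
    unfolding power2_norm_eq_inner by (subst euclidean_inner) (simp add: power2_eq_square)
  then have "gaussian x = exp (\<Sum>b\<in>Basis. - (x \<bullet> b)\<^sup>2 / 2)"
    unfolding gaussian_def by (simp add: sum_negf sum_divide_distrib)
  then show ?thesis by (simp add: exp_sum)
qed

text \<open>The transform is the characteristic function of the standard normal distribution. That
  function has the kernel with the opposite sign, so it is taken at \<open>- t\<close>; the
  normalisation of the density supplies the factor sqrt(2 pi).\<close>

lemma
  shows integrable_gaussian_real: "integrable lborel (\<lambda>x::real. exp (- x\<^sup>2 / 2))"
    and fourier_gaussian_real: "(\<integral>x. complex_of_real (exp (- x\<^sup>2 / 2)) * exp (- (\<i> * complex_of_real (x * t))) \<partial>lborel)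
      = complex_of_real (sqrt (2 * pi) * exp (- t\<^sup>2 / 2))"
proof -
  have d: "std_normal_density x = exp (- x\<^sup>2 / 2) / sqrt (2 * pi)" for x
    by (simp add: std_normal_density_def)
  have "integrable lborel std_normal_density"
    using integrable_normal_density[of 1 0] by simp
  from integrable_mult_right[OF this, of "sqrt (2 * pi)"]
  show "integrable lborel (\<lambda>x::real. exp (- x\<^sup>2 / 2))" by (simp add: d)
  have "complex_of_real (exp (- t\<^sup>2 / 2)) = char std_normal_distribution (- t)"
    by (simp add: char_std_normal_distribution)
  also have "\<dots> = (\<integral>x. std_normal_density x *\<^sub>R exp (\<i> * complex_of_real (- t * x)) \<partial>lborel)"
    unfolding char_def by (rule integral_density) auto
  also have "\<dots> = (\<integral>x. complex_of_real (1 / sqrt (2 * pi)) *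
      (complex_of_real (exp (- x\<^sup>2 / 2)) * exp (- (\<i> * complex_of_real (x * t)))) \<partial>lborel)"
    by (rule Bochner_Integration.integral_cong) (simp_all add: d scaleR_conv_of_real ac_simps)
  also have "\<dots> = complex_of_real (1 / sqrt (2 * pi)) *
      (\<integral>x. complex_of_real (exp (- x\<^sup>2 / 2)) * exp (- (\<i> * complex_of_real (x * t))) \<partial>lborel)"
    by (rule integral_mult_right_zero)
  finally show "(\<integral>x. complex_of_real (exp (- x\<^sup>2 / 2)) * exp (- (\<i> * complex_of_real (x * t))) \<partial>lborel)
      = complex_of_real (sqrt (2 * pi) * exp (- t\<^sup>2 / 2))"
    by (simp add: field_simps flip: of_real_mult)
qed

lemma integrable_gaussian: "integrable lborel (gaussian :: 'a::euclidean_space \<Rightarrow> real)"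
  unfolding gaussian_eq_prod[abs_def]
  by (rule integrable_prod_Basis) (rule integrable_gaussian_real)

lemma fourier_gaussian:
  fixes \<xi> :: "'a::euclidean_space"
  shows "(\<integral>x. complex_of_real (gaussian x) * exp (- (\<i> * complex_of_real (x \<bullet> \<xi>))) \<partial>lborel)
    = complex_of_real (sqrt (2 * pi) ^ DIM('a) * gaussian \<xi>)"
proof -
  let ?F = "\<lambda>b t. complex_of_real (exp (- t\<^sup>2 / 2)) * exp (- (\<i> * complex_of_real (t * (\<xi> \<bullet> b))))"
  have int: "integrable lborel (?F b)" for b
  proof (rule Bochner_Integration.integrable_bound[OF integrable_gaussian_real])
    show "?F b \<in> borel_measurable lborel" by measurable
  qed (simp add: norm_mult)
  have "complex_of_real (gaussian x) * exp (- (\<i> * complex_of_real (x \<bullet> \<xi>)))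
      = (\<Prod>b\<in>Basis. ?F b (x \<bullet> b))" for x
  proof -
    have "- (\<i> * complex_of_real (x \<bullet> \<xi>)) = (\<Sum>b\<in>Basis. - (\<i> * complex_of_real ((x \<bullet> b) * (\<xi> \<bullet> b))))"
      by (subst euclidean_inner) (simp add: sum_negf sum_distrib_left)
    then show ?thesis
      by (simp add: gaussian_eq_prod exp_sum prod.distrib del: of_real_mult)
  qed
  then have "(\<integral>x. complex_of_real (gaussian x) * exp (- (\<i> * complex_of_real (x \<bullet> \<xi>))) \<partial>lborel)
      = (\<Prod>b\<in>Basis. \<integral>t. ?F b t \<partial>lborel)"
    using integral_prod_Basis[of ?F, OF int] by simp
  also have "\<dots> = (\<Prod>b\<in>(Basis::'a set). complex_of_real (sqrt (2 * pi) * exp (- (\<xi> \<bullet> b)\<^sup>2 / 2)))"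
    by (simp only: fourier_gaussian_real)
  also have "\<dots> = complex_of_real (sqrt (2 * pi) ^ DIM('a) * gaussian \<xi>)"
    by (simp add: gaussian_eq_prod prod.distrib flip: of_real_prod)
  finally show ?thesis .
qed


section \<open>The Fourier transform on the Schwartz space\<close>

lemma rapid_decay_decay_weight:
  fixes \<phi> :: "real ^ 'd \<Rightarrow> complex"
  assumes "rapid_decay \<phi>"
  obtains C where "C \<ge> 0" "\<And>x. norm (\<phi> x) \<le> C * decay_weight x"
proof -
  obtain C where C: "C \<ge> 0" "\<And>x. (1 + norm x) ^ (2 * DIM(real ^ 'd)) * norm (\<phi> x) \<le> C"
    using rapid_decayD[OF assms] by metis
  have "norm (\<phi> x) \<le> C * decay_weight x" for x
  proof -
    have "(1 + norm x) ^ (2 * DIM(real ^ 'd)) > 0" by (simp add: add_pos_nonneg)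
    then show ?thesis using C(2)[of x] unfolding decay_weight_def
      by (simp add: field_simps)
  qed
  then show thesis using C(1) that by blast
qed

lemma schwartz_continuous: "\<phi> \<in> schwartz \<Longrightarrow> continuous_on UNIV \<phi>"
  using has_grad_continuous schwartz_has_grad by blast

lemma schwartz_measurable: "\<phi> \<in> schwartz \<Longrightarrow> \<phi> \<in> borel_measurable borel"
  using schwartz_continuous borel_measurable_continuous_onI by blast

lemma schwartz_integrable:
  fixes \<phi> :: "real ^ 'd \<Rightarrow> complex"
  assumes "\<phi> \<in> schwartz"
  shows "integrable lborel \<phi>"
proof -
  obtain C where C: "C \<ge> 0" "\<And>x. norm (\<phi> x) \<le> C * decay_weight x"
    using rapid_decay_decay_weight[OF schwartz_rapid_decay[OF assms]] by blast
  show ?thesis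
  proof (rule Bochner_Integration.integrable_bound)
    show "integrable lborel (\<lambda>x::real ^ 'd. C * decay_weight x)"
      by (intro integrable_mult_right integrable_decay_weight)
    show "AE x in lborel. norm (\<phi> x) \<le> norm (C * decay_weight x)"
      using order_trans[OF C(2) abs_ge_self] by (intro AE_I2) simp
  qed (use schwartz_measurable[OF assms] in simp)
qed

lemma fourier_altdef:
  "fourier \<phi> \<xi> = (LINT x|lborel. \<phi> x * exp (- (\<i> * complex_of_real (x \<bullet> \<xi>))))"
  by (simp add: fourier_def)

lemma schwartz_fourier_integrable:
  assumes "\<phi> \<in> schwartz"
  shows "integrable lborel (\<lambda>x. \<phi> x * exp (- (\<i> * complex_of_real (x \<bullet> \<xi>))))"
proof (rule Bochner_Integration.integrable_bound[OF schwartz_integrable[OF assms]])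
  have [measurable]: "\<phi> \<in> borel_measurable borel" by (rule schwartz_measurable[OF assms])
  show "(\<lambda>x. \<phi> x * exp (- (\<i> * complex_of_real (x \<bullet> \<xi>)))) \<in> borel_measurable lborel"
    by measurable
qed (simp add: norm_mult)

lemma fourier_cmult: "fourier (\<lambda>x. c * \<phi> x) \<xi> = c * fourier \<phi> \<xi>"
  by (simp add: fourier_def mult.assoc)

lemma norm_fourier_le: "norm (fourier \<phi> \<xi>) \<le> (LINT x|lborel. norm (\<phi> x))"
  unfolding fourier_altdef
  using integral_norm_bound[of lborel "\<lambda>x. \<phi> x * exp (- (\<i> * complex_of_real (x \<bullet> \<xi>)))"]
  by (simp add: norm_mult)

text \<open>Once the unimodular factor exp(- i a) is taken out, this is the first-order Taylor
  estimate for exp(- i r).\<close>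

lemma fourier_kernel_remainder:
  fixes a r :: real
  shows "norm (exp (- (\<i> * complex_of_real (a + r))) - exp (- (\<i> * complex_of_real a))
    + \<i> * complex_of_real r * exp (- (\<i> * complex_of_real a))) \<le> r\<^sup>2"
proof -
  have "exp (- (\<i> * complex_of_real (a + r))) - exp (- (\<i> * complex_of_real a))
      + \<i> * complex_of_real r * exp (- (\<i> * complex_of_real a))
    = exp (- (\<i> * complex_of_real a)) * (exp (\<i> * complex_of_real (- r)) - (1 + \<i> * complex_of_real (- r)))"
    by (simp add: algebra_simps flip: exp_add)
  also have "norm \<dots> \<le> \<bar>- r\<bar> ^ 2 / 2"
    using iexp_approx1[of "- r" 1] by (simp add: norm_mult numeral_2_eq_2)
  also have "\<dots> \<le> r\<^sup>2" by simp
  finally show ?thesis .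
qed

lemma has_grad_fourier:
  fixes \<phi> :: "real ^ 'd \<Rightarrow> complex"
  assumes "\<phi> \<in> schwartz"
  shows "has_grad (fourier \<phi>) (\<lambda>j. fourier (\<lambda>x. - \<i> * (x $ j *\<^sub>R \<phi> x)))"
  unfolding has_grad_def
proof
  fix \<xi> :: "real ^ 'd"
  let ?E = "\<lambda>x. exp (- (\<i> * complex_of_real (x \<bullet> \<xi>)))"
  let ?F' = "\<lambda>h x. \<phi> x * (- (\<i> * complex_of_real (x \<bullet> h) * ?E x))"
  have [measurable]: "\<phi> \<in> borel_measurable borel" by (rule schwartz_measurable[OF assms])
  have coord: "(\<lambda>x. - \<i> * (x $ j *\<^sub>R \<phi> x)) \<in> schwartz" for j
    by (intro schwartz_cmult schwartz_coord assms)
  have F'_eq: "?F' h x = (\<Sum>j\<in>UNIV. h $ j *\<^sub>R (- \<i> * (x $ j *\<^sub>R \<phi> x) * ?E x))" for h x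
  proof -
    have "(\<Sum>j\<in>UNIV. h $ j *\<^sub>R (- \<i> * (x $ j *\<^sub>R \<phi> x) * ?E x))
        = (\<Sum>j\<in>UNIV. complex_of_real (x $ j * h $ j)) * (- \<i> * \<phi> x * ?E x)"
      unfolding sum_distrib_right by (rule sum.cong) (simp_all add: scaleR_conv_of_real)
    then show ?thesis by (simp add: inner_vec_def)
  qed
  have int: "integrable lborel (\<lambda>x. h $ j *\<^sub>R (- \<i> * (x $ j *\<^sub>R \<phi> x) * ?E x))" for h :: "real ^ 'd" and j
    by (intro integrable_scaleR_right schwartz_fourier_integrable coord)
  have intF': "(\<integral>x. ?F' h x \<partial>lborel)
      = (\<Sum>j\<in>UNIV. h $ j *\<^sub>R fourier (\<lambda>x. - \<i> * (x $ j *\<^sub>R \<phi> x)) \<xi>)" for h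
    unfolding F'_eq fourier_altdef Bochner_Integration.integral_sum[OF int] integral_scaleR_right ..
  have "((\<lambda>\<xi>. \<integral>x. \<phi> x * exp (- (\<i> * complex_of_real (x \<bullet> \<xi>))) \<partial>lborel) has_derivative
      (\<lambda>h. \<integral>x. ?F' h x \<partial>lborel)) (at \<xi>)"
  proof (rule has_derivative_integral_of_quadratic_remainder)
    show "(1::real) > 0" by simp
    show "integrable lborel (\<lambda>x. \<phi> x * exp (- (\<i> * complex_of_real (x \<bullet> (\<xi> + h)))))" for h
      by (rule schwartz_fourier_integrable[OF assms])
    show "bounded_linear (\<lambda>h. \<integral>x. ?F' h x \<partial>lborel)"
      unfolding intF'
      by (intro bounded_linear_sum bounded_linear_scaleR_const bounded_linear_vec_nth)
    show "integrable lborel (?F' h)" for h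
      unfolding F'_eq using int by (intro Bochner_Integration.integrable_sum)
    \<comment> \<open>The majorant |x|^2 |phi| is the sum of the |x_j x_j phi|, and each x_j x_j phi
      is a Schwartz function.\<close>
    have "integrable lborel (\<lambda>x. \<Sum>j\<in>UNIV. norm (x $ j *\<^sub>R (x $ j *\<^sub>R \<phi> x)))"
      by (intro Bochner_Integration.integrable_sum integrable_norm schwartz_integrable schwartz_coord assms)
    moreover have "(\<Sum>j\<in>UNIV. norm (x $ j *\<^sub>R (x $ j *\<^sub>R \<phi> x))) = (norm x)\<^sup>2 * norm (\<phi> x)" for x
      unfolding power2_norm_eq_inner inner_vec_def sum_distrib_right
      by (rule sum.cong) (simp_all add: abs_mult_self_eq flip: mult.assoc)
    ultimately show "integrable lborel (\<lambda>x. (norm x)\<^sup>2 * norm (\<phi> x))" by simp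
    fix h x :: "real ^ 'd"
    have "\<phi> x * exp (- (\<i> * complex_of_real (x \<bullet> (\<xi> + h)))) - \<phi> x * ?E x - ?F' h x
        = \<phi> x * (exp (- (\<i> * complex_of_real (x \<bullet> \<xi> + x \<bullet> h))) - ?E x + \<i> * complex_of_real (x \<bullet> h) * ?E x)"
      by (simp add: algebra_simps)
    also have "norm \<dots> \<le> norm (\<phi> x) * (x \<bullet> h)\<^sup>2"
      unfolding norm_mult[of "\<phi> x"] by (intro mult_left_mono fourier_kernel_remainder) simp
    also have "\<dots> \<le> norm (\<phi> x) * (norm x * norm h)\<^sup>2"
      using Cauchy_Schwarz_ineq2[of x h] by (intro mult_left_mono) (auto simp flip: abs_le_square_iff simp: abs_mult)
    also have "\<dots> = (norm h)\<^sup>2 * ((norm x)\<^sup>2 * norm (\<phi> x))" by (simp add: power_mult_distrib)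
    finally show "norm (\<phi> x * exp (- (\<i> * complex_of_real (x \<bullet> (\<xi> + h)))) - \<phi> x * ?E x - ?F' h x)
        \<le> (norm h)\<^sup>2 * ((norm x)\<^sup>2 * norm (\<phi> x))" .
  qed
  then show "(fourier \<phi> has_derivative
      (\<lambda>h. \<Sum>j\<in>UNIV. h $ j *\<^sub>R fourier (\<lambda>x. - \<i> * (x $ j *\<^sub>R \<phi> x)) \<xi>)) (at \<xi>)"
    unfolding intF' by (simp add: fourier_altdef[abs_def])
qed

lemma schwartz_line_derivative:
  assumes "\<phi> \<in> schwartz"
  shows "((\<lambda>t. \<phi> (x + t *\<^sub>R axis j 1)) has_vector_derivative pderivs [j] \<phi> (x + t *\<^sub>R axis j 1)) (at t within S)"
proof -
  let ?D = "\<lambda>h. \<Sum>i\<in>UNIV. h $ i *\<^sub>R pderivs [i] \<phi> (x + t *\<^sub>R axis j 1)"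
  have "((\<lambda>t. x + t *\<^sub>R axis j 1) has_derivative (\<lambda>s. s *\<^sub>R axis j 1)) (at t within S)"
    by (auto intro!: derivative_eq_intros)
  from has_derivative_compose[OF this has_gradD[OF schwartz_has_grad[OF assms]]]
  have "((\<lambda>t. \<phi> (x + t *\<^sub>R axis j 1)) has_derivative (\<lambda>s. ?D (s *\<^sub>R axis j 1))) (at t within S)" .
  moreover have "?D (s *\<^sub>R axis j 1) = s *\<^sub>R pderivs [j] \<phi> (x + t *\<^sub>R axis j 1)" for s
  proof -
    have "?D (s *\<^sub>R axis j 1)
        = (\<Sum>i\<in>UNIV. if i = j then s *\<^sub>R pderivs [i] \<phi> (x + t *\<^sub>R axis j 1) else 0)"
      by (rule sum.cong) (auto simp: axis_def)
    then show ?thesis by simp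
  qed
  ultimately show ?thesis by (simp add: has_vector_derivative_def)
qed

text \<open>Yields one integrable majorant for all translates by vectors of length at most 1. The
  factor is 2^(2 d), from 1 + |x| \<le> 2 (1 + |x + y|).\<close>

lemma decay_weight_translate:
  fixes x y :: "'a::euclidean_space"
  assumes "norm y \<le> 1"
  shows "decay_weight (x + y) \<le> 4 ^ DIM('a) * decay_weight x"
proof -
  have "norm x \<le> norm (x + y) + norm y" by (metis add_diff_cancel_right' norm_triangle_ineq4)
  then have "norm x \<le> norm (x + y) + 1" using assms by linarith
  then have "1 + norm x \<le> 2 * (1 + norm (x + y))" using norm_ge_zero[of "x + y"] by argo
  then have "(1 + norm x) ^ (2 * DIM('a)) \<le> (2 * (1 + norm (x + y))) ^ (2 * DIM('a))"
    by (intro power_mono) auto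
  also have "\<dots> = 4 ^ DIM('a) * (1 + norm (x + y)) ^ (2 * DIM('a))"
    by (simp only: power_mult_distrib power_mult) simp
  finally show ?thesis
    unfolding decay_weight_def by (simp add: field_simps add_pos_nonneg)
qed

text \<open>Differentiating the translate \<open>x \<mapsto> \<phi> (x + t e\<^sub>j)\<close> in \<open>t\<close> under the integral replaces an
  integration by parts.\<close>

lemma fourier_pderivs:
  fixes \<phi> :: "real ^ 'd \<Rightarrow> complex"
  assumes \<phi>: "\<phi> \<in> schwartz"
  shows "fourier (pderivs [j] \<phi>) \<xi> = \<i> * complex_of_real (\<xi> $ j) * fourier \<phi> \<xi>"
proof -
  let ?E = "\<lambda>x. exp (- (\<i> * complex_of_real (x \<bullet> \<xi>)))"
  let ?e = "axis j 1 :: real ^ 'd"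
  have [measurable]: "\<phi> \<in> borel_measurable borel" by (rule schwartz_measurable[OF \<phi>])
  \<comment> \<open>Translation invariance turns the shift into the phase exp(i t \<xi>_j). Its
    derivative at t = 0 gives the right side of the claim, the derivative under the integral the
    left side.\<close>
  have shift: "(\<integral>x. \<phi> (x + t *\<^sub>R ?e) * ?E x \<partial>lborel) = exp (\<i> * complex_of_real (t * \<xi> $ j)) * fourier \<phi> \<xi>" for t
  proof -
    have "(\<integral>x. \<phi> (x + t *\<^sub>R ?e) * ?E x \<partial>lborel)
        = (\<integral>x. exp (\<i> * complex_of_real (t * \<xi> $ j)) * (\<phi> (x + t *\<^sub>R ?e) * ?E (x + t *\<^sub>R ?e)) \<partial>lborel)"
      by (rule Bochner_Integration.integral_cong)
        (simp_all add: inner_add_left inner_axis' algebra_simps flip: exp_add)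
    also have "\<dots> = exp (\<i> * complex_of_real (t * \<xi> $ j)) * fourier \<phi> \<xi>"
      using lborel_integral_translate[of "\<lambda>x. \<phi> x * ?E x" "t *\<^sub>R ?e"] by (simp add: fourier_altdef)
    finally show ?thesis .
  qed
  have shift_int: "integrable lborel (\<lambda>x. \<phi> (x + t *\<^sub>R ?e) * ?E x)" if "\<bar>t\<bar> < 1" for t
  proof -
    obtain C where C: "C \<ge> 0" "\<And>x. norm (\<phi> x) \<le> C * decay_weight x"
      using rapid_decay_decay_weight[OF schwartz_rapid_decay[OF \<phi>]] by blast
    show ?thesis
    proof (rule Bochner_Integration.integrable_bound)
      show "integrable lborel (\<lambda>x::real ^ 'd. C * (4 ^ DIM(real ^ 'd) * decay_weight x))"
        by (intro integrable_mult_right integrable_decay_weight)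
      have *: "norm (\<phi> (x + t *\<^sub>R ?e) * ?E x) \<le> C * (4 ^ DIM(real ^ 'd) * decay_weight x)" for x
        using C(2)[of "x + t *\<^sub>R ?e"] mult_left_mono[OF decay_weight_translate[of "t *\<^sub>R ?e" x] C(1)] that
        by (simp add: norm_mult)
      show "AE x in lborel. norm (\<phi> (x + t *\<^sub>R ?e) * ?E x) \<le> norm (C * (4 ^ DIM(real ^ 'd) * decay_weight x))"
        using order_trans[OF * abs_ge_self] by (intro AE_I2) (simp only: real_norm_def)
    qed measurable
  qed
  \<comment> \<open>The second derivative along e_j controls the quadratic remainder in
    \<open>t\<close>, uniformly over all shifts of length below 1.\<close>
  obtain C where C: "C \<ge> 0" "\<And>x. norm (pderivs [j, j] \<phi> x) \<le> C * decay_weight x"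
    using rapid_decay_decay_weight[OF schwartz_rapid_decay[OF schwartz_pderivs[OF \<phi>]]] by blast
  have "((\<lambda>t. \<integral>x. \<phi> (x + t *\<^sub>R ?e) * ?E x \<partial>lborel) has_derivative
      (\<lambda>h. \<integral>x. h *\<^sub>R (pderivs [j] \<phi> x * ?E x) \<partial>lborel)) (at 0)"
  proof (rule has_derivative_integral_of_quadratic_remainder)
    show "(1::real) > 0" by simp
    show "integrable lborel (\<lambda>x. \<phi> (x + (0 + t) *\<^sub>R ?e) * ?E x)" if "norm t < 1" for t
      using shift_int[of t] that by simp
    show "bounded_linear (\<lambda>h. \<integral>x. h *\<^sub>R (pderivs [j] \<phi> x * ?E x) \<partial>lborel)"
      using bounded_linear_scaleR_left by simp
    show "integrable lborel (\<lambda>x. h *\<^sub>R (pderivs [j] \<phi> x * ?E x))" for h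
      by (intro integrable_scaleR_right schwartz_fourier_integrable schwartz_pderivs \<phi>)
    show "integrable lborel (\<lambda>x::real ^ 'd. C * (4 ^ DIM(real ^ 'd) * decay_weight x))"
      by (intro integrable_mult_right integrable_decay_weight)
    fix h :: real and x :: "real ^ 'd" assume h: "norm h < 1"
    let ?K = "C * (4 ^ DIM(real ^ 'd) * decay_weight x)"
    let ?f = "\<lambda>t. \<phi> (x + t *\<^sub>R ?e)"
    let ?f' = "\<lambda>t. pderivs [j] \<phi> (x + t *\<^sub>R ?e)"
    have K: "norm (pderivs [j, j] \<phi> (x + t *\<^sub>R ?e)) \<le> ?K" if "\<bar>t\<bar> \<le> \<bar>h\<bar>" for t
      using C(2)[of "x + t *\<^sub>R ?e"] mult_left_mono[OF decay_weight_translate[of "t *\<^sub>R ?e" x] C(1)] that h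
      by simp
    have lip: "norm (?f' t - ?f' 0) \<le> \<bar>h\<bar> * ?K" if t: "t \<in> {- \<bar>h\<bar>..\<bar>h\<bar>}" for t
    proof -
      have "norm (?f' t - ?f' 0) \<le> ?K * norm (t - 0)"
      proof (rule differentiable_bound)
        fix s assume "s \<in> {- \<bar>h\<bar>..\<bar>h\<bar>}"
        then have s: "\<bar>s\<bar> \<le> \<bar>h\<bar>" by auto
        show "(?f' has_derivative (\<lambda>r. r *\<^sub>R pderivs [j, j] \<phi> (x + s *\<^sub>R ?e))) (at s within {- \<bar>h\<bar>..\<bar>h\<bar>})"
          using schwartz_line_derivative[OF schwartz_pderivs[OF \<phi>, of "[j]"], of x j s "{- \<bar>h\<bar>..\<bar>h\<bar>}"]
          by (simp add: has_vector_derivative_def)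
        show "onorm (\<lambda>r. r *\<^sub>R pderivs [j, j] \<phi> (x + s *\<^sub>R ?e)) \<le> ?K"
          by (rule onorm_le) (use mult_left_mono[OF K[OF s]] in \<open>simp add: mult.commute\<close>)
      qed (use t in auto)
      also have "\<dots> \<le> ?K * \<bar>h\<bar>"
        using t C(1) decay_weight_pos[of x] by (intro mult_left_mono) (auto simp: less_imp_le)
      finally show ?thesis by (simp add: mult.commute)
    qed
    \<comment> \<open>Up to the time \<open>h\<close> the velocity \<open>?f'\<close> deviates from
      its initial value by at most |h| K; the mean value estimate supplies the second factor
      |h|.\<close>
    have "norm (?f h - ?f 0 - (h - 0) *\<^sub>R ?f' 0) \<le> norm (h - 0) * (\<bar>h\<bar> * ?K)"
    proof (rule vector_differentiable_bound_linearization[where S = "{- \<bar>h\<bar>..\<bar>h\<bar>}" and f = ?f and f' = ?f'])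
      show "(?f has_vector_derivative ?f' s) (at s within {- \<bar>h\<bar>..\<bar>h\<bar>})" for s
        by (rule schwartz_line_derivative[OF \<phi>])
      show "closed_segment 0 h \<subseteq> {- \<bar>h\<bar>..\<bar>h\<bar>}"
        by (auto simp: closed_segment_eq_real_ivl split: if_splits)
      show "norm (?f' s - ?f' 0) \<le> \<bar>h\<bar> * ?K" if "s \<in> {- \<bar>h\<bar>..\<bar>h\<bar>}" for s
        by (rule lip[OF that])
      show "0 \<in> {- \<bar>h\<bar>..\<bar>h\<bar>}" by simp
    qed
    then have *: "norm (?f h - \<phi> x - h *\<^sub>R pderivs [j] \<phi> x) \<le> (norm h)\<^sup>2 * ?K"
      by (simp add: power2_eq_square mult.assoc)
    have "\<phi> (x + (0 + h) *\<^sub>R ?e) * ?E x - \<phi> (x + 0 *\<^sub>R ?e) * ?E x - h *\<^sub>R (pderivs [j] \<phi> x * ?E x)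
        = (?f h - \<phi> x - h *\<^sub>R pderivs [j] \<phi> x) * ?E x"
      by (simp add: algebra_simps)
    then show "norm (\<phi> (x + (0 + h) *\<^sub>R ?e) * ?E x - \<phi> (x + 0 *\<^sub>R ?e) * ?E x - h *\<^sub>R (pderivs [j] \<phi> x * ?E x))
        \<le> (norm h)\<^sup>2 * ?K"
      using * by (simp only: norm_mult norm_exp_minus_i mult_1_right)
  qed
  then have "((\<lambda>t. exp (\<i> * complex_of_real (t * \<xi> $ j)) * fourier \<phi> \<xi>) has_vector_derivative
      fourier (pderivs [j] \<phi>) \<xi>) (at 0)"
    unfolding shift by (simp add: has_vector_derivative_def fourier_altdef)
  moreover have "((\<lambda>t. exp (\<i> * complex_of_real (t * \<xi> $ j)) * fourier \<phi> \<xi>) has_vector_derivative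
      \<i> * complex_of_real (\<xi> $ j) * fourier \<phi> \<xi>) (at 0)"
  proof -
    have "((\<lambda>z. exp (\<i> * (z * complex_of_real (\<xi> $ j))) * fourier \<phi> \<xi>) has_field_derivative
        \<i> * complex_of_real (\<xi> $ j) * fourier \<phi> \<xi>) (at (complex_of_real 0))"
      by (auto intro!: derivative_eq_intros)
    from has_vector_derivative_real_field[OF this] show ?thesis by simp
  qed
  ultimately show ?thesis by (rule vector_derivative_unique_at)
qed

text \<open>By 1 + |\<xi>| \<le> 1 + \<Sum> |\<xi>_j| each power of the weight is paid for with one
  derivative, because |\<xi>_j| times the transform of phi is in modulus the transform of its j-th
  derivative. The induction therefore ranges over all Schwartz functions.\<close>

lemma rapid_decay_fourier:
  fixes \<phi> :: "real ^ 'd \<Rightarrow> complex"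
  assumes "\<phi> \<in> schwartz"
  shows "rapid_decay (fourier \<phi>)"
proof -
  have "\<exists>C. \<forall>\<xi>. (1 + norm \<xi>) ^ k * norm (fourier \<phi> \<xi>) \<le> C" if "\<phi> \<in> schwartz" for k and \<phi> :: "real ^ 'd \<Rightarrow> complex"
    using that
  proof (induction k arbitrary: \<phi>)
    case 0
    then show ?case using norm_fourier_le by auto
  next
    case (Suc k)
    obtain C where C: "\<And>\<xi>. (1 + norm \<xi>) ^ k * norm (fourier \<phi> \<xi>) \<le> C"
      using Suc.IH[OF Suc.prems] by blast
    have "\<exists>D. \<forall>\<xi>. (1 + norm \<xi>) ^ k * norm (fourier (pderivs [j] \<phi>) \<xi>) \<le> D" for j
      using Suc.IH[OF schwartz_pderivs[OF Suc.prems]] .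
    then obtain D where D: "\<And>j \<xi>. (1 + norm \<xi>) ^ k * norm (fourier (pderivs [j] \<phi>) \<xi>) \<le> D j"
      by metis
    have "(1 + norm \<xi>) ^ Suc k * norm (fourier \<phi> \<xi>) \<le> C + (\<Sum>j\<in>UNIV. D j)" for \<xi>
    proof -
      let ?w = "(1 + norm \<xi>) ^ k * norm (fourier \<phi> \<xi>)"
      have "(1 + norm \<xi>) ^ Suc k * norm (fourier \<phi> \<xi>) = (1 + norm \<xi>) * ?w" by simp
      also have "\<dots> \<le> (1 + (\<Sum>j\<in>UNIV. \<bar>\<xi> $ j\<bar>)) * ?w"
        using norm_le_l1_cart[of \<xi>] by (intro mult_right_mono) auto
      also have "\<dots> = ?w + (\<Sum>j\<in>UNIV. (1 + norm \<xi>) ^ k * norm (fourier (pderivs [j] \<phi>) \<xi>))"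
      proof -
        have "(1 + norm \<xi>) ^ k * norm (fourier (pderivs [j] \<phi>) \<xi>) = \<bar>\<xi> $ j\<bar> * ?w" for j
          unfolding fourier_pderivs[OF Suc.prems] by (simp add: norm_mult)
        then show ?thesis by (simp only: distrib_right sum_distrib_right mult_1_left)
      qed
      also have "\<dots> \<le> C + (\<Sum>j\<in>UNIV. D j)"
        using C D by (intro add_mono sum_mono)
      finally show ?thesis .
    qed
    then show ?case by blast
  qed
  then show ?thesis using assms unfolding rapid_decay_def by blast
qed

lemma fourier_schwartz:
  assumes "\<phi> \<in> schwartz"
  shows "fourier \<phi> \<in> schwartz"
proof (rule schwartz_coinduct)
  let ?A = "fourier ` schwartz"
  show "fourier \<phi> \<in> ?A" using assms by blast
  fix \<eta> :: "real ^ 'a \<Rightarrow> complex" assume "\<eta> \<in> ?A"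
  then obtain \<phi> where *: "\<eta> = fourier \<phi>" "\<phi> \<in> schwartz" by blast
  show "rapid_decay \<eta>" using * rapid_decay_fourier by blast
  have "fourier (\<lambda>x. - \<i> * (x $ j *\<^sub>R \<phi> x)) \<in> ?A" for j
    by (intro imageI schwartz_cmult schwartz_coord *)
  then show "\<exists>\<eta>'. has_grad \<eta> \<eta>' \<and> (\<forall>j. \<eta>' j \<in> ?A)" using has_grad_fourier[OF *(2)] *(1) by blast
qed


section \<open>Fourier inversion\<close>

lemma lborel_integrable_affine:
  fixes f :: "'a::euclidean_space \<Rightarrow> 'b::{banach, second_countable_topology}"
  assumes f: "integrable lborel f" and c: "c \<noteq> 0"
  shows "integrable lborel (\<lambda>x. f (t + c *\<^sub>R x))"
proof -
  have [measurable]: "f \<in> borel_measurable borel" using f by simp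
  have "integrable (density (distr lborel borel (\<lambda>x. t + c *\<^sub>R x)) (\<lambda>_. ennreal (\<bar>c\<bar> ^ DIM('a)))) f"
    using f lborel_affine[OF c, of t] by (simp add: ennreal_power)
  then have "integrable (distr lborel borel (\<lambda>x. t + c *\<^sub>R x)) (\<lambda>x. \<bar>c\<bar> ^ DIM('a) *\<^sub>R f x)"
    by (subst (asm) integrable_density) auto
  then have "integrable (distr lborel borel (\<lambda>x. t + c *\<^sub>R x)) f"
    using integrable_scaleR_right[of "inverse (\<bar>c\<bar> ^ DIM('a))"] c by fastforce
  then show ?thesis by (subst (asm) integrable_distr_eq) auto
qed

text \<open>Fubini: the kernel is symmetric and unimodular, so the double integral converges
  absolutely with majorant |f(x)| |g(\<xi>)|.\<close>

lemma fourier_multiplication_formula: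
  fixes f g :: "real ^ 'd \<Rightarrow> complex"
  assumes f: "integrable lborel f" and g: "integrable lborel g"
  shows "(\<integral>\<xi>. fourier f \<xi> * g \<xi> \<partial>lborel) = (\<integral>x. f x * fourier g x \<partial>lborel)"
proof -
  let ?h = "\<lambda>x \<xi>. f x * (exp (- (\<i> * complex_of_real (x \<bullet> \<xi>))) * g \<xi>)"
  have [measurable]: "f \<in> borel_measurable borel" "g \<in> borel_measurable borel"
    using f g by auto
  have "integrable (lborel \<Otimes>\<^sub>M lborel) (case_prod ?h)"
  proof (rule lborel_pair.Fubini_integrable)
    show "case_prod ?h \<in> borel_measurable (lborel \<Otimes>\<^sub>M lborel)"
      by measurable
    show "integrable lborel (\<lambda>x. \<integral>\<xi>. norm (case_prod ?h (x, \<xi>)) \<partial>lborel)"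
      using f by (simp add: norm_mult)
    have "integrable lborel (\<lambda>\<xi>. exp (- (\<i> * complex_of_real (x \<bullet> \<xi>))) * g \<xi>)" for x
      by (rule Bochner_Integration.integrable_bound[OF g]) (auto simp: norm_mult)
    then show "AE x in lborel. integrable lborel (\<lambda>\<xi>. case_prod ?h (x, \<xi>))"
      by (intro AE_I2) simp
  qed
  from lborel_pair.Fubini_integral[OF this]
  have "(\<integral>\<xi>. (\<integral>x. ?h x \<xi> \<partial>lborel) \<partial>lborel) = (\<integral>x. (\<integral>\<xi>. ?h x \<xi> \<partial>lborel) \<partial>lborel)" .
  moreover have "(\<integral>x. ?h x \<xi> \<partial>lborel) = fourier f \<xi> * g \<xi>" for \<xi>
    by (simp add: fourier_altdef flip: mult.assoc)
  moreover have "(\<integral>\<xi>. ?h x \<xi> \<partial>lborel) = f x * fourier g x" for x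
    by (simp add: fourier_altdef inner_commute mult.commute[of "g _"])
  ultimately show ?thesis by (simp only:)
qed

lemma abs_gaussian [simp]: "\<bar>gaussian x\<bar> = gaussian x"
  by (simp add: gaussian_def)

lemma gaussian_0 [simp]: "gaussian 0 = 1"
  by (simp add: gaussian_def)

lemma tendsto_gaussian [tendsto_intros]: "(f \<longlongrightarrow> a) F \<Longrightarrow> ((\<lambda>x. gaussian (f x)) \<longlongrightarrow> gaussian a) F"
  unfolding gaussian_def by (intro tendsto_intros) auto

lemma fourier_gaussian_vec:
  fixes x :: "real ^ 'd"
  shows "fourier (\<lambda>x. complex_of_real (gaussian x)) x = complex_of_real (sqrt (2 * pi) ^ CARD('d) * gaussian x)"
  unfolding fourier_altdef fourier_gaussian by simp

text \<open>The left side is the inversion integral with a Gaussian cut-off of width 1/c. After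
  rescaling it pairs the transform of z -> phi(x + c z) with the Gaussian; the multiplication
  formula moves the transform onto the Gaussian, where it is explicit. What results is an average of
  phi around \<open>x\<close> at scale \<open>c\<close>.\<close>

lemma fourier_gaussian_regularisation:
  fixes \<phi> :: "real ^ 'd \<Rightarrow> complex"
  assumes \<phi>: "\<phi> \<in> schwartz" and c: "c > 0"
  shows "(\<integral>\<xi>. fourier \<phi> \<xi> * exp (\<i> * complex_of_real (x \<bullet> \<xi>)) * complex_of_real (gaussian (c *\<^sub>R \<xi>)) \<partial>lborel)
    = complex_of_real (sqrt (2 * pi) ^ CARD('d)) * (\<integral>z. \<phi> (x + c *\<^sub>R z) * complex_of_real (gaussian z) \<partial>lborel)"
proof -
  let ?d = "CARD('d)"
  have [measurable]: "\<phi> \<in> borel_measurable borel" "fourier \<phi> \<in> borel_measurable borel"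
    by (intro schwartz_measurable fourier_schwartz \<phi>)+
  let ?f = "\<lambda>z. \<phi> (x + c *\<^sub>R z)"
  let ?g = "\<lambda>z::real ^ 'd. complex_of_real (gaussian z)"
  let ?H = "\<lambda>\<xi>. fourier \<phi> \<xi> * exp (\<i> * complex_of_real (x \<bullet> \<xi>)) * ?g (c *\<^sub>R \<xi>)"
  have ff: "c ^ ?d *\<^sub>R fourier ?f (c *\<^sub>R \<xi>) = fourier \<phi> \<xi> * exp (\<i> * complex_of_real (x \<bullet> \<xi>))" for \<xi>
  proof -
    let ?F = "\<lambda>y. \<phi> y * exp (- (\<i> * complex_of_real ((y - x) \<bullet> \<xi>)))"
    have "(\<integral>y. ?F y \<partial>lborel) = c ^ ?d *\<^sub>R (\<integral>z. ?F (x + c *\<^sub>R z) \<partial>lborel)"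
      using lborel_integral_affine[of ?F c x] c by simp
    also have "(\<integral>z. ?F (x + c *\<^sub>R z) \<partial>lborel) = fourier ?f (c *\<^sub>R \<xi>)"
      unfolding fourier_altdef by simp
    also have "?F y = \<phi> y * exp (- (\<i> * complex_of_real (y \<bullet> \<xi>))) * exp (\<i> * complex_of_real (x \<bullet> \<xi>))" for y
      by (simp add: inner_diff_left right_diff_distrib exp_diff exp_minus field_simps)
    then have "(\<integral>y. ?F y \<partial>lborel) = fourier \<phi> \<xi> * exp (\<i> * complex_of_real (x \<bullet> \<xi>))"
      unfolding fourier_altdef by (simp only: integral_mult_left_zero)
    finally show ?thesis by simp
  qed
  have "(\<integral>\<xi>. ?H \<xi> \<partial>lborel) = (\<integral>\<xi>. c ^ ?d *\<^sub>R (fourier ?f (c *\<^sub>R \<xi>) * ?g (c *\<^sub>R \<xi>)) \<partial>lborel)"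
    unfolding ff[symmetric] by simp
  also have "\<dots> = c ^ ?d *\<^sub>R (\<integral>\<xi>. fourier ?f (0 + c *\<^sub>R \<xi>) * ?g (0 + c *\<^sub>R \<xi>) \<partial>lborel)"
    by simp
  also have "\<dots> = (\<integral>\<xi>. fourier ?f \<xi> * ?g \<xi> \<partial>lborel)"
  proof -
    \<comment> \<open>Measurability of the transform of \<open>?f\<close> is obtained by expressing
      it through that of \<open>\<phi>\<close>.\<close>
    have "(\<lambda>\<xi>. fourier ?f \<xi>) = (\<lambda>\<xi>. inverse (c ^ ?d) *\<^sub>R
        (fourier \<phi> (inverse c *\<^sub>R \<xi>) * exp (\<i> * complex_of_real (x \<bullet> (inverse c *\<^sub>R \<xi>)))))"
      unfolding ff[symmetric] using c by simp
    then have [measurable]: "fourier ?f \<in> borel_measurable borel" by simp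
    show ?thesis
      using lborel_integral_affine[of "\<lambda>\<xi>. fourier ?f \<xi> * ?g \<xi>" c 0] c by simp
  qed
  also have "\<dots> = (\<integral>z. ?f z * fourier ?g z \<partial>lborel)"
  proof (rule fourier_multiplication_formula)
    show "integrable lborel ?f"
      using c by (intro lborel_integrable_affine schwartz_integrable \<phi>) auto
    show "integrable lborel ?g" using integrable_gaussian by (intro integrable_of_real)
  qed
  also have "\<dots> = (\<integral>z. complex_of_real (sqrt (2 * pi) ^ ?d) * (?f z * ?g z) \<partial>lborel)"
    unfolding fourier_gaussian_vec by (simp add: ac_simps)
  finally show ?thesis by simp
qed

lemma inv_fourier_eq:
  fixes \<psi> :: "real ^ 'd \<Rightarrow> complex"
  shows "inv_fourier \<psi> x = complex_of_real (inverse ((2 * pi) ^ CARD('d))) * fourier \<psi> (- x)"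
  by (simp add: inv_fourier_def fourier_altdef inner_commute field_simps)

lemma inv_fourier_schwartz:
  assumes "\<psi> \<in> schwartz"
  shows "inv_fourier \<psi> \<in> schwartz"
  using schwartz_cmult[OF schwartz_reflect[OF fourier_schwartz[OF assms]]]
  unfolding inv_fourier_eq[abs_def] .

text \<open>Let c tend to 0 in the regularised identity. By dominated convergence the cut-off tends
  to 1 on the left and phi(x + c z) to phi(x) on the right, which leaves the total mass of the
  Gaussian.\<close>

lemma inv_fourier_fourier:
  fixes \<phi> :: "real ^ 'd \<Rightarrow> complex"
  assumes \<phi>: "\<phi> \<in> schwartz"
  shows "inv_fourier (fourier \<phi>) = \<phi>"
proof
  fix x :: "real ^ 'd"
  let ?d = "CARD('d)"
  let ?c = "\<lambda>n. inverse (real (Suc n))"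
  let ?g = "\<lambda>z::real ^ 'd. complex_of_real (gaussian z)"
  let ?s = "complex_of_real (sqrt (2 * pi) ^ ?d)"
  have [measurable]: "\<phi> \<in> borel_measurable borel" "fourier \<phi> \<in> borel_measurable borel"
    by (intro schwartz_measurable fourier_schwartz \<phi>)+
  have c: "?c \<longlonglongrightarrow> 0" by (rule LIMSEQ_inverse_real_of_nat)
  have 1: "(\<lambda>n. \<integral>\<xi>. fourier \<phi> \<xi> * exp (\<i> * complex_of_real (x \<bullet> \<xi>)) * ?g (?c n *\<^sub>R \<xi>) \<partial>lborel)
      \<longlonglongrightarrow> (\<integral>\<xi>. fourier \<phi> \<xi> * exp (\<i> * complex_of_real (x \<bullet> \<xi>)) \<partial>lborel)"
  proof (rule integral_dominated_convergence)
    show "integrable lborel (\<lambda>\<xi>. norm (fourier \<phi> \<xi>))"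
      by (intro integrable_norm schwartz_integrable fourier_schwartz \<phi>)
    show "AE \<xi> in lborel. (\<lambda>n. fourier \<phi> \<xi> * exp (\<i> * complex_of_real (x \<bullet> \<xi>)) * ?g (?c n *\<^sub>R \<xi>))
        \<longlonglongrightarrow> fourier \<phi> \<xi> * exp (\<i> * complex_of_real (x \<bullet> \<xi>))"
    proof (rule AE_I2)
      fix \<xi> :: "real ^ 'd"
      have "(\<lambda>n. fourier \<phi> \<xi> * exp (\<i> * complex_of_real (x \<bullet> \<xi>)) * ?g (?c n *\<^sub>R \<xi>))
          \<longlonglongrightarrow> fourier \<phi> \<xi> * exp (\<i> * complex_of_real (x \<bullet> \<xi>)) * ?g (0 *\<^sub>R \<xi>)"
        by (intro tendsto_intros c)
      then show "(\<lambda>n. fourier \<phi> \<xi> * exp (\<i> * complex_of_real (x \<bullet> \<xi>)) * ?g (?c n *\<^sub>R \<xi>))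
          \<longlonglongrightarrow> fourier \<phi> \<xi> * exp (\<i> * complex_of_real (x \<bullet> \<xi>))" by simp
    qed
    show "AE \<xi> in lborel. norm (fourier \<phi> \<xi> * exp (\<i> * complex_of_real (x \<bullet> \<xi>)) * ?g (?c n *\<^sub>R \<xi>))
        \<le> norm (fourier \<phi> \<xi>)" for n
      by (intro AE_I2) (simp add: norm_mult mult_left_le gaussian_bounds)
  qed measurable
  obtain C where C: "\<And>y. norm (\<phi> y) \<le> C"
    using rapid_decayD[OF schwartz_rapid_decay[OF \<phi>], of 0] by auto
  have 2: "(\<lambda>n. \<integral>z. \<phi> (x + ?c n *\<^sub>R z) * ?g z \<partial>lborel) \<longlonglongrightarrow> (\<integral>z. \<phi> x * ?g z \<partial>lborel)"
  proof (rule integral_dominated_convergence)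
    show "integrable lborel (\<lambda>z::real ^ 'd. C * gaussian z)"
      by (intro integrable_mult_right integrable_gaussian)
    show "AE z in lborel. (\<lambda>n. \<phi> (x + ?c n *\<^sub>R z) * ?g z) \<longlonglongrightarrow> \<phi> x * ?g z"
    proof (rule AE_I2)
      fix z :: "real ^ 'd"
      have "isCont \<phi> (x + 0 *\<^sub>R z)"
        using schwartz_continuous[OF \<phi>] by (simp add: continuous_on_eq_continuous_at)
      then have "(\<lambda>n. \<phi> (x + ?c n *\<^sub>R z)) \<longlonglongrightarrow> \<phi> (x + 0 *\<^sub>R z)"
        by (rule isCont_tendsto_compose) (intro tendsto_intros c)
      then show "(\<lambda>n. \<phi> (x + ?c n *\<^sub>R z) * ?g z) \<longlonglongrightarrow> \<phi> x * ?g z"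
        by (intro tendsto_mult tendsto_const) simp
    qed
    show "AE z in lborel. norm (\<phi> (x + ?c n *\<^sub>R z) * ?g z) \<le> C * gaussian z" for n
      using mult_right_mono[OF C less_imp_le[OF gaussian_bounds(1)]]
      by (intro AE_I2) (simp add: norm_mult)
  qed measurable
  have "(\<lambda>n. ?s * (\<integral>z. \<phi> (x + ?c n *\<^sub>R z) * ?g z \<partial>lborel)) \<longlonglongrightarrow> ?s * (\<integral>z. \<phi> x * ?g z \<partial>lborel)"
    by (intro tendsto_mult tendsto_const 2)
  then have "(\<lambda>n. \<integral>\<xi>. fourier \<phi> \<xi> * exp (\<i> * complex_of_real (x \<bullet> \<xi>)) * ?g (?c n *\<^sub>R \<xi>) \<partial>lborel)
      \<longlonglongrightarrow> ?s * (\<integral>z. \<phi> x * ?g z \<partial>lborel)"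
    by (simp add: fourier_gaussian_regularisation[OF \<phi>])
  then have "(\<integral>\<xi>. fourier \<phi> \<xi> * exp (\<i> * complex_of_real (x \<bullet> \<xi>)) \<partial>lborel)
      = ?s * (\<integral>z. \<phi> x * ?g z \<partial>lborel)"
    by (rule LIMSEQ_unique[OF 1])
  \<comment> \<open>The mass of the Gaussian is its transform at 0. It contributes a second factor
    sqrt(2 pi)^d, completing the (2 pi)^d by which \<open>inv_fourier\<close> divides.\<close>
  also have "\<dots> = ?s * (\<phi> x * fourier ?g 0)" by (simp add: fourier_altdef)
  also have "\<dots> = (?s * ?s) * \<phi> x" unfolding fourier_gaussian_vec by simp
  also have "?s * ?s = complex_of_real ((2 * pi) ^ ?d)"
  proof -
    have "sqrt (2 * pi) ^ ?d * sqrt (2 * pi) ^ ?d = (2 * pi) ^ ?d"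
      unfolding power_mult_distrib[symmetric] real_sqrt_mult_self by simp
    then show ?thesis unfolding of_real_mult[symmetric] by (rule arg_cong)
  qed
  finally show "inv_fourier (fourier \<phi>) x = \<phi> x"
    by (simp add: inv_fourier_def)
qed

text \<open>The two transforms differ by a constant and a reflection, and reflection commutes with
  \<open>fourier\<close>; the left inverse found above is thus a right inverse too.\<close>

lemma fourier_inv_fourier:
  fixes \<psi> :: "real ^ 'd \<Rightarrow> complex"
  assumes \<psi>: "\<psi> \<in> schwartz"
  shows "fourier (inv_fourier \<psi>) = \<psi>"
proof
  fix \<xi> :: "real ^ 'd"
  let ?c = "complex_of_real (inverse ((2 * pi) ^ CARD('d)))"
  have [measurable]: "fourier \<psi> \<in> borel_measurable borel"
    using \<psi> by (intro schwartz_measurable fourier_schwartz)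
  have "fourier (inv_fourier \<psi>) \<xi> = ?c * fourier (\<lambda>x. fourier \<psi> (- x)) \<xi>"
    unfolding inv_fourier_eq[abs_def] by (rule fourier_cmult)
  also have "fourier (\<lambda>x. fourier \<psi> (- x)) \<xi> = fourier (fourier \<psi>) (- \<xi>)"
    using lborel_integral_reflect[of "\<lambda>x. fourier \<psi> x * exp (- (\<i> * complex_of_real (x \<bullet> (- \<xi>))))"]
    unfolding fourier_altdef[of _ \<xi>] fourier_altdef[of _ "- \<xi>"] by simp
  also have "?c * fourier (fourier \<psi>) (- \<xi>) = \<psi> \<xi>"
    using inv_fourier_eq[of "fourier \<psi>" \<xi>] inv_fourier_fourier[OF \<psi>] by simp
  finally show "fourier (inv_fourier \<psi>) \<xi> = \<psi> \<xi>" .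
qed

section \<open>The solution spaces\<close>

lemma Z_space_iff: "\<phi> \<in> Z_space \<longleftrightarrow> \<phi> \<in> schwartz \<and> fourier \<phi> \<in> flat_schwartz"
  using fourier_schwartz by (auto simp: Z_space_def flat_schwartz_def)

lemma inv_fourier_Z_space:
  assumes "\<psi> \<in> flat_schwartz"
  shows "inv_fourier \<psi> \<in> Z_space"
proof -
  have "\<psi> \<in> schwartz" using assms by (simp add: flat_schwartz_def)
  then show ?thesis
    unfolding Z_space_iff using assms by (simp add: inv_fourier_schwartz fourier_inv_fourier)
qed

lemma Z_space_cmult:
  assumes "\<phi> \<in> Z_space"
  shows "(\<lambda>x. c * \<phi> x) \<in> Z_space"
proof -
  have *: "\<phi> \<in> schwartz" "fourier \<phi> \<in> flat_schwartz" using assms by (auto simp: Z_space_iff)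
  have "flat_upto n (\<lambda>x. c * fourier \<phi> x)" for n
    by (rule flat_upto_cmult[OF flat_schwartz_flat_upto[OF *(2)]])
  then have "fourier (\<lambda>x. c * \<phi> x) \<in> flat_schwartz"
    unfolding fourier_cmult[abs_def] by (rule flat_schwartzI)
  then show ?thesis using schwartz_cmult[OF *(1)] by (auto simp: Z_space_iff)
qed

lemma Z_dual_linear:
  assumes "u \<in> Z_dual" "\<phi> \<in> Z_space" "\<psi> \<in> Z_space"
  shows "u (\<lambda>x. \<phi> x + \<psi> x) = u \<phi> + u \<psi>" "u (\<lambda>x. c * \<phi> x) = c * u \<phi>"
  using assms by (auto simp: Z_dual_def topological_dual_def topspace_Z_topology)

lemma inv_fourier_add:
  assumes "\<phi> \<in> schwartz" "\<psi> \<in> schwartz"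
  shows "inv_fourier (\<lambda>\<xi>. \<phi> \<xi> + \<psi> \<xi>) x = inv_fourier \<phi> x + inv_fourier \<psi> x"
  using assms[THEN schwartz_fourier_integrable, of "- x"]
  by (simp add: inv_fourier_eq fourier_altdef distrib_right distrib_left)

text \<open>Moderate growth keeps g(-\<Delta>) phi in \<open>Z_space\<close>, so linearity of
  \<open>u\<close> merges the two sides of the equation into one function with symbol g(|\<xi>|^2) -
  g(1).\<close>

lemma Z_dual_symbol:
  fixes u :: "(real ^ 'd \<Rightarrow> complex) \<Rightarrow> complex"
  assumes u: "u \<in> Z_dual" and g: "\<And>n. moderate n g" and \<phi>: "\<phi> \<in> Z_space"
  shows "u (inv_fourier (\<lambda>\<xi>. complex_of_real (g ((norm \<xi>)\<^sup>2) - g 1) * fourier \<phi> \<xi>))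
    = u (fun_neg_laplacian g \<phi>) - u (\<lambda>x. complex_of_real (g 1) * \<phi> x)"
proof -
  let ?c = "complex_of_real (g 1)"
  let ?p = "\<lambda>\<xi>. complex_of_real (g ((norm \<xi>)\<^sup>2)) * fourier \<phi> \<xi>"
  have *: "\<phi> \<in> schwartz" "fourier \<phi> \<in> flat_schwartz" using \<phi> by (auto simp: Z_space_iff)
  have p: "?p \<in> flat_schwartz" by (rule flat_schwartz_radial_mult[OF g *(2)])
  then have pZ: "fun_neg_laplacian g \<phi> \<in> Z_space"
    unfolding fun_neg_laplacian_def by (rule inv_fourier_Z_space)
  \<comment> \<open>The minus sign is put into the scalar, since \<open>Z_dual_linear\<close> offers
    sums and multiples.\<close>
  have cZ: "(\<lambda>x. - ?c * \<phi> x) \<in> Z_space" by (rule Z_space_cmult[OF \<phi>])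
  have "inv_fourier (\<lambda>\<xi>. complex_of_real (g ((norm \<xi>)\<^sup>2) - g 1) * fourier \<phi> \<xi>)
      = inv_fourier (\<lambda>\<xi>. ?p \<xi> + fourier (\<lambda>x. - ?c * \<phi> x) \<xi>)"
    by (rule arg_cong[of _ _ inv_fourier]) (simp only: fourier_cmult, simp add: algebra_simps)
  also have "\<dots> = (\<lambda>x. fun_neg_laplacian g \<phi> x + - ?c * \<phi> x)"
  proof
    fix x
    have "inv_fourier (\<lambda>\<xi>. ?p \<xi> + fourier (\<lambda>x. - ?c * \<phi> x) \<xi>) x
        = inv_fourier ?p x + inv_fourier (fourier (\<lambda>x. - ?c * \<phi> x)) x"
      using p by (intro inv_fourier_add fourier_schwartz schwartz_cmult *) (simp add: flat_schwartz_def)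
    then show "inv_fourier (\<lambda>\<xi>. ?p \<xi> + fourier (\<lambda>x. - ?c * \<phi> x) \<xi>) x = fun_neg_laplacian g \<phi> x + - ?c * \<phi> x"
      by (simp only: inv_fourier_fourier[OF schwartz_cmult[OF *(1)]] fun_neg_laplacian_def)
  qed
  finally show ?thesis
    by (simp only: Z_dual_linear(1)[OF u pZ cZ] Z_dual_linear(2)[OF u \<phi> \<phi>]) simp
qed

lemma Z_dual_equation_iff:
  fixes u :: "(real ^ 'd \<Rightarrow> complex) \<Rightarrow> complex"
  assumes u: "u \<in> Z_dual" and g: "\<And>n. moderate n g"
  shows "(\<forall>\<phi>\<in>Z_space. u (fun_neg_laplacian g \<phi>) = u (\<lambda>x. complex_of_real (g 1) * \<phi> x))
    \<longleftrightarrow> (\<forall>\<psi>\<in>flat_schwartz. u (inv_fourier (\<lambda>\<xi>. complex_of_real (g ((norm \<xi>)\<^sup>2) - g 1) * \<psi> \<xi>)) = 0)"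
    (is "?L \<longleftrightarrow> ?R")
proof
  assume L: ?L
  show ?R
  proof
    fix \<psi> :: "real ^ 'd \<Rightarrow> complex" assume \<psi>: "\<psi> \<in> flat_schwartz"
    then have "fourier (inv_fourier \<psi>) = \<psi>" by (intro fourier_inv_fourier) (simp add: flat_schwartz_def)
    then show "u (inv_fourier (\<lambda>\<xi>. complex_of_real (g ((norm \<xi>)\<^sup>2) - g 1) * \<psi> \<xi>)) = 0"
      using Z_dual_symbol[OF u g inv_fourier_Z_space[OF \<psi>]] L inv_fourier_Z_space[OF \<psi>] by simp
  qed
next
  assume R: ?R
  show ?L
  proof
    fix \<phi> :: "real ^ 'd \<Rightarrow> complex" assume \<phi>: "\<phi> \<in> Z_space"
    then have "fourier \<phi> \<in> flat_schwartz" by (simp add: Z_space_iff)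
    then show "u (fun_neg_laplacian g \<phi>) = u (\<lambda>x. complex_of_real (g 1) * \<phi> x)"
      using Z_dual_symbol[OF u g \<phi>] R by simp
  qed
qed

text \<open>The factor \<open>q\<close> is absorbed into the test function, which stays flat. Two
  arbitrary symbols are allowed so that both directions are covered, with q = h and q = 1/h.\<close>

lemma flat_symbol_quotient:
  fixes u :: "(real ^ 'd \<Rightarrow> complex) \<Rightarrow> complex"
  assumes q: "\<And>s. s > 0 \<Longrightarrow> f s - f 1 = (g s - g 1) * q s" and mod: "\<And>n. moderate n q"
    and u: "\<forall>\<psi>\<in>flat_schwartz. u (inv_fourier (\<lambda>\<xi>. complex_of_real (g ((norm \<xi>)\<^sup>2) - g 1) * \<psi> \<xi>)) = 0"
  shows "\<forall>\<psi>\<in>flat_schwartz. u (inv_fourier (\<lambda>\<xi>. complex_of_real (f ((norm \<xi>)\<^sup>2) - f 1) * \<psi> \<xi>)) = 0"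
proof
  fix \<psi> :: "real ^ 'd \<Rightarrow> complex" assume \<psi>: "\<psi> \<in> flat_schwartz"
  have eq: "complex_of_real (f ((norm \<xi>)\<^sup>2) - f 1) * \<psi> \<xi>
      = complex_of_real (g ((norm \<xi>)\<^sup>2) - g 1) * (complex_of_real (q ((norm \<xi>)\<^sup>2)) * \<psi> \<xi>)" for \<xi>
  proof (cases "\<xi> = 0")
    case True
    \<comment> \<open>The factorisation holds for s > 0; at the origin both sides vanish together
      with psi.\<close>
    then show ?thesis using flat_schwartz_rapidly_flat[OF \<psi>] by (simp add: rapidly_flat_def)
  next
    case False
    then have "f ((norm \<xi>)\<^sup>2) - f 1 = (g ((norm \<xi>)\<^sup>2) - g 1) * q ((norm \<xi>)\<^sup>2)"
      by (intro q) simp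
    then show ?thesis by (simp only: of_real_mult mult.assoc)
  qed
  show "u (inv_fourier (\<lambda>\<xi>. complex_of_real (f ((norm \<xi>)\<^sup>2) - f 1) * \<psi> \<xi>)) = 0"
    unfolding eq using u flat_schwartz_radial_mult[OF mod \<psi>] by simp
qed

theorem theorem1p8:
  fixes f :: "real \<Rightarrow> real"
  assumes "bernstein_function f"
    and "\<not> f constant_on {0<..}"
  shows "(solution_space f :: ((real ^ 'd \<Rightarrow> complex) \<Rightarrow> complex) set)
       = solution_space (\<lambda>s. s)"
proof -
  obtain h where h: "\<And>s. s > 0 \<Longrightarrow> f s - f 1 = (s - 1) * h s" "\<And>s. s > 0 \<Longrightarrow> h s \<noteq> 0"
    "\<And>n. moderate n h" "\<And>n. moderate n (\<lambda>s. inverse (h s))" "\<And>n. moderate n f"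
    using bernstein_divided_difference[OF assms] by blast
  have h': "s - 1 = (f s - f 1) * inverse (h s)" if "s > 0" for s
    using h(1,2)[OF that] by simp
  have eq: "(\<forall>\<phi>\<in>Z_space. u (fun_neg_laplacian f \<phi>) = u (\<lambda>x. complex_of_real (f 1) * \<phi> x))
      \<longleftrightarrow> (\<forall>\<phi>\<in>Z_space. u (fun_neg_laplacian (\<lambda>s. s) \<phi>) = u (\<lambda>x. complex_of_real 1 * \<phi> x))"
    if u: "u \<in> Z_dual" for u :: "(real ^ 'd \<Rightarrow> complex) \<Rightarrow> complex"
    unfolding Z_dual_equation_iff[OF u h(5)] Z_dual_equation_iff[OF u moderate_ident]
    \<comment> \<open>From \<open>f\<close> to the identity the quotient is 1/h, in the other
      direction it is h.\<close>
    by (rule iffI[OF flat_symbol_quotient[of "\<lambda>s. s" f "\<lambda>s. inverse (h s)" u, OF h' h(4)]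
          flat_symbol_quotient[of f "\<lambda>s. s" h u, OF h(1,3)]])
  show ?thesis
    unfolding solution_space_def
    by (rule Collect_cong, rule conj_cong[OF refl]) (simp only: eq)
qed

end
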